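(* Let $N\ge 1$ be an integer, let $N<p<\infty$ and $p\le q\le\infty$, and let $\Omega\subseteq\mathbb{R}^N$ be an open set with finite inradius $r_\Omega$. Then \[ \lambda_{p,q}(\Omega)\ \ge\ \big(\beta_{N,p}\big)^{\frac pq}\,\Big(\Lambda_{p,\infty}(B_1\setminus\{0\})\Big)^{1-\frac pq}\,\left(\frac1{r_\Omega}\right)^{p-N+N\frac pq}, \] where \[ \beta_{N,p}=\max\left\{\frac{\Lambda_p(B_1\setminus\{0\})}{(\sqrt N+1)^p},\ \left(\frac{p-N}{p}\right)^p\right\}. \]
   Context: $B_1\subseteq\mathbb{R}^N$ is the open unit ball centered at the origin; when $q=\infty$, $p/q$ is understood as $0$. For an open set $\Omega\subseteq\mathbb{R}^N$, the inradius is $r_\Omega=\sup\{r>0 : \text{there exists a ball } B_r(x_0)\subseteq\Omega\}$, and \[ \lambda_{p,q}(\Omega)=\inf_{u\in C^\infty_0(\Omega)\setminus\{0\}}\frac{\|\nabla u\|_{L^p(\Omega)}^p}{\|u\|_{L^q(\Omega)}^p}. \] For $p>N$, the punctured Poincaré constants of the ball are \[ \Lambda_p(B_1\setminus\{0\})=\inf_{u\in\mathrm{Lip}(\overline{B_1})}\left\{\int_{B_1}|\nabla u|^p\,dx : \|u\|_{L^p(B_1)}=1,\ u(0)=0\right\}, \] \[ \Lambda_{p,\infty}(B_1\setminus\{0\})=\inf_{u\in\mathrm{Lip}(\overline{B_1})}\left\{\int_{B_1}|\nabla u|^p\,dx : \|u\|_{L^\infty(B_1)}=1,\ u(0)=0\right\}.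 \] *)

theory Defs
  imports "HOL-Analysis.Analysis" "HOL-Probability.Essential_Supremum"
begin

text \<open>
  The gradient is the classical one, set to \<open>0\<close> at points of non-differentiability. It is only
  applied to smooth functions and to Lipschitz functions; the latter are differentiable almost
  everywhere (Rademacher), and there the classical gradient agrees with the weak one.
\<close>

definition grad :: "('a::euclidean_space \<Rightarrow> real) \<Rightarrow> 'a \<Rightarrow> 'a" where
  "grad u x = (if u differentiable (at x) then (THE D. GDERIV u x :> D) else 0)"

primrec C_k :: "nat \<Rightarrow> ('a::euclidean_space \<Rightarrow> real) \<Rightarrow> bool" where
  "C_k 0 u \<longleftrightarrow> continuous_on UNIV u"
| "C_k (Suc k) u \<longleftrightarrow> (\<forall>x. u differentiable (at x)) \<and> (\<forall>i\<in>Basis. C_k k (\<lambda>x. grad u x \<bullet> i))"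

text \<open>Elements of \<open>C\<^sub>0\<^sup>\<infinity>(\<Omega>)\<close> are identified with their extension by zero to the whole space.\<close>

definition test_functions :: "'a::euclidean_space set \<Rightarrow> ('a \<Rightarrow> real) set" where
  "test_functions \<Omega> =
     {u. (\<forall>k. C_k k u) \<and> compact (closure {x. u x \<noteq> 0}) \<and> closure {x. u x \<noteq> 0} \<subseteq> \<Omega>}"

text \<open>
  The norm is real-valued: it is only used for functions whose norm is finite, namely test
  functions, their gradients, and Lipschitz functions on the unit ball.
\<close>

definition Lp_norm ::
  "ereal \<Rightarrow> 'a::euclidean_space set \<Rightarrow> ('a \<Rightarrow> 'b::real_normed_vector) \<Rightarrow> real" where
  "Lp_norm q S f =
     (if q = \<infinity> then enn2real (esssup (lebesgue_on S) (\<lambda>x. ennreal (norm (f x))))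
      else (LINT x|lebesgue_on S. norm (f x) powr real_of_ereal q) powr (1 / real_of_ereal q))"

definition inradius :: "'a::euclidean_space set \<Rightarrow> ennreal" where
  "inradius \<Omega> = (SUP r \<in> {r::real. r > 0 \<and> (\<exists>x\<^sub>0. ball x\<^sub>0 r \<subseteq> \<Omega>)}. ennreal r)"

text \<open>
  The infimum is taken in the extended half-line, so that it equals \<open>\<infinity>\<close> for \<open>\<Omega> = {}\<close>, which
  admits no nonzero test function. The quotients themselves are finite, with nonzero denominator
  when \<open>\<Omega>\<close> is open.
\<close>

definition lambda_pq :: "real \<Rightarrow> ereal \<Rightarrow> 'a::euclidean_space set \<Rightarrow> ennreal" where
  "lambda_pq p q \<Omega> =
     (INF u \<in> test_functions \<Omega> - {\<lambda>_. 0}.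
        ennreal (Lp_norm (ereal p) \<Omega> (grad u) powr p / Lp_norm q \<Omega> u powr p))"

text \<open>
  The punctured constant of the unit ball of the space \<open>'a\<close>, with normalization in \<open>L\<^sup>q\<close>: \<open>q = p\<close>
  gives \<open>\<Lambda>\<^sub>p\<close> and \<open>q = \<infinity>\<close> gives \<open>\<Lambda>\<^sub>p\<^sub>,\<^sub>\<infinity>\<close>. Values of \<open>u\<close> outside the closed unit ball are irrelevant.
  The integrand is bounded and measurable for every admissible \<open>u\<close>, and admissible functions exist
  (multiples of the norm), so both the integral and the infimum are genuine.
\<close>

definition punctured_const :: "real \<Rightarrow> ereal \<Rightarrow> 'a::euclidean_space itself \<Rightarrow> real" where
  "punctured_const p q _ =
     Inf {LINT x|lebesgue_on (ball (0::'a) 1). norm (grad u x) powr p | u.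
            (\<exists>L. L-lipschitz_on (cball 0 1) u) \<and> Lp_norm q (ball 0 1) u = 1 \<and> u 0 = 0}"

definition beta :: "real \<Rightarrow> 'a::euclidean_space itself \<Rightarrow> real" where
  "beta p T =
     (let N = real DIM('a) in
      max (punctured_const p (ereal p) T / (sqrt N + 1) powr p) (((p - N) / p) powr p))"

end

theory Submission
  imports Defs
begin

text \<open>
  By interpolation between \<open>L\<^sup>p\<close> and \<open>L\<^sup>\<infinity>\<close>, only the cases \<open>q = p\<close> and \<open>q = \<infinity>\<close> matter.

  For \<open>q = \<infinity>\<close>, take a point \<open>y\<close> outside \<open>\<Omega>\<close> at distance less than \<open>R\<close> (any \<open>R > r\<^sub>\<Omega>\<close>) from a
  maximum point of \<open>\<bar>u\<bar>\<close>; rescaling \<open>u\<close> from the ball of radius \<open>R\<close> about \<open>y\<close> to the unit ball gives an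
  admissible function for \<open>\<Lambda>\<^sub>p\<^sub>,\<^sub>\<infinity>\<close>.

  For \<open>q = p\<close>, the support of \<open>u\<close> lies within distance \<open>R\<close> of a finite set \<open>F\<close> of points outside \<open>\<Omega>\<close>.
  On each Voronoi cell of \<open>F\<close>, cut off at distance \<open>R\<close> from its centre, integrate along the rays from
  the centre, where \<open>u\<close> vanishes. Star-shapedness reduces the claim to the one-dimensional weighted inequality
  \<open>\<beta> \<integral>\<^sub>0\<^sup>1 s\<^bsup>N-1\<^esup> \<bar>g\<bar>\<^sup>p ds \<le> \<integral>\<^sub>0\<^sup>1 s\<^bsup>N-1\<^esup> \<bar>g'\<bar>\<^sup>p ds\<close> for \<open>g\<close> vanishing near \<open>0\<close>. With \<open>((p-N)/p)\<^sup>p\<close> in place of \<open>\<beta>\<close>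
  this is Hardy's inequality, and with \<open>\<Lambda>\<^sub>p\<close> it follows by testing \<open>\<Lambda>\<^sub>p\<close> with the radial function
  \<open>g(\<bar>x\<bar>)\<close>. In particular the factor \<open>(\<surd>N + 1)\<^sup>p\<close> is not lost on this route.
\<close>

section \<open>Integration along rays\<close>

lemma nn_integral_lborel_scale:
  fixes f :: "'a::euclidean_space \<Rightarrow> ennreal"
  assumes [measurable]: "f \<in> borel_measurable borel" and c: "0 < c"
  shows "(\<integral>\<^sup>+z. f z \<partial>lborel) = ennreal (c ^ DIM('a)) * (\<integral>\<^sup>+x. f (y + c *\<^sub>R x) \<partial>lborel)"
  using c by (subst lborel_affine[of c y])
    (simp_all add: nn_integral_density nn_integral_distr nn_integral_cmult)

lemma nn_integral_inverse_Ioo: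
  fixes r :: real
  assumes "0 < r"
  shows "(\<integral>\<^sup>+s. ennreal (1 / s) * indicator {r / 2<..<r} s \<partial>lborel) = ennreal (ln 2)"
proof -
  have "(\<integral>\<^sup>+s. ennreal (1 / s) * indicator {r / 2<..<r} s \<partial>lborel)
      = (\<integral>\<^sup>+s. ennreal (1 / s) * indicator {r / 2..r} s \<partial>lborel)"
  proof (rule nn_integral_cong_AE)
    have "AE s in lborel. s \<noteq> r" "AE s in lborel. s \<noteq> r / 2"
      by (rule AE_lborel_singleton)+
    then show "AE s in lborel. ennreal (1 / s) * indicator {r / 2<..<r} s
        = ennreal (1 / s) * indicator {r / 2..r} s"
      by eventually_elim (auto simp: indicator_def)
  qed
  also have "\<dots> = ennreal (ln r - ln (r / 2))"
    using assms by (intro nn_integral_FTC_Icc) (auto intro!: derivative_eq_intros)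
  also have "ln r - ln (r / 2) = ln 2"
    using assms by (simp add: ln_div)
  finally show ?thesis .
qed

text \<open>
  Integration in polar coordinates without a surface measure: the rays are parametrised by the
  points of an annulus, each ray being hit with the total weight \<open>\<integral> ds / s = ln 2\<close>.
\<close>

lemma nn_integral_rays:
  fixes F :: "'a::euclidean_space \<Rightarrow> ennreal"
  assumes [measurable]: "F \<in> borel_measurable borel"
  shows "(\<integral>\<^sup>+x\<in>{x. 1 < norm x \<and> norm x < 2}.
      (\<integral>\<^sup>+s\<in>{0<..}. ennreal (s ^ (DIM('a) - 1)) * F (s *\<^sub>R x) \<partial>lborel) \<partial>lborel)
    = ennreal (ln 2) * (\<integral>\<^sup>+z. F z \<partial>lborel)"
proof -
  let ?A = "{x::'a. 1 < norm x \<and> norm x < 2}"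
  \<comment> \<open>Under z = s x the annulus condition on x becomes |z|/2 < s < |z|. Since dx =
    s^(-N) dz, the factor 1/s is what remains of s^(N-1).\<close>
  define J :: "'a \<Rightarrow> real \<Rightarrow> ennreal" where
    "J z s = (if norm z / 2 < s \<and> s < norm z then ennreal (1 / s) else 0)" for z s
  have [measurable]: "?A \<in> sets borel" by measurable
  have [measurable]: "(\<lambda>(z, s). J z s) \<in> borel_measurable (borel \<Otimes>\<^sub>M borel)"
    unfolding J_def by measurable
  have "(\<integral>\<^sup>+x\<in>?A. (\<integral>\<^sup>+s\<in>{0<..}. ennreal (s ^ (DIM('a) - 1)) * F (s *\<^sub>R x) \<partial>lborel) \<partial>lborel)
      = (\<integral>\<^sup>+x. (\<integral>\<^sup>+s. ennreal (s ^ (DIM('a) - 1)) * indicator {0<..} s *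
          (F (s *\<^sub>R x) * indicator ?A x) \<partial>lborel) \<partial>lborel)"
    by (subst nn_integral_multc[symmetric]) (simp_all add: mult_ac)
  also have "\<dots> = (\<integral>\<^sup>+s. (\<integral>\<^sup>+x. ennreal (s ^ (DIM('a) - 1)) * indicator {0<..} s *
          (F (s *\<^sub>R x) * indicator ?A x) \<partial>lborel) \<partial>lborel)"
    by (rule lborel_pair.Fubini') measurable
  also have "\<dots> = (\<integral>\<^sup>+s. (\<integral>\<^sup>+z. F z * J z s \<partial>lborel) \<partial>lborel)"
  proof (rule nn_integral_cong)
    fix s :: real
    show "(\<integral>\<^sup>+x. ennreal (s ^ (DIM('a) - 1)) * indicator {0<..} s *
          (F (s *\<^sub>R x) * indicator ?A x) \<partial>lborel) = (\<integral>\<^sup>+z. F z * J z s \<partial>lborel)"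
    proof (cases "s > 0")
      case True
      have J: "J (s *\<^sub>R x) s = ennreal (1 / s) * indicator ?A x" for x :: 'a
        using True by (auto simp: J_def indicator_def)
      have "s ^ DIM('a) = s * s ^ (DIM('a) - 1)"
        by (metis DIM_positive Suc_pred' power_Suc)
      then have s: "s ^ DIM('a) * (1 / s) = s ^ (DIM('a) - 1)"
        using True by simp
      have "(\<integral>\<^sup>+z. F z * J z s \<partial>lborel)
          = ennreal (s ^ DIM('a)) * (\<integral>\<^sup>+x. F (0 + s *\<^sub>R x) * J (0 + s *\<^sub>R x) s \<partial>lborel)"
        by (rule nn_integral_lborel_scale) (use True in measurable)
      also have "\<dots> = (\<integral>\<^sup>+x. ennreal (s ^ DIM('a)) * (F (s *\<^sub>R x) * (ennreal (1 / s) * indicator ?A x)) \<partial>lborel)"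
        unfolding add_0 J by (rule nn_integral_cmult[symmetric]) measurable
      also have "\<dots> = (\<integral>\<^sup>+x. (ennreal (s ^ DIM('a)) * ennreal (1 / s)) * (F (s *\<^sub>R x) * indicator ?A x) \<partial>lborel)"
        by (intro nn_integral_cong) (simp only: mult_ac)
      also have "ennreal (s ^ DIM('a)) * ennreal (1 / s) = ennreal (s ^ (DIM('a) - 1))"
        using True s by (subst ennreal_mult[symmetric]) auto
      finally show ?thesis using True by simp
    next
      case False
      then have "J z s = 0" for z
        using norm_ge_zero[of z] by (simp add: J_def del: norm_ge_zero)
      then show ?thesis using False by simp
    qed
  qed
  also have "\<dots> = (\<integral>\<^sup>+z. (\<integral>\<^sup>+s. F z * J z s \<partial>lborel) \<partial>lborel)"
    by (rule lborel_pair.Fubini') measurable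
  also have "\<dots> = (\<integral>\<^sup>+z. F z * ennreal (ln 2) \<partial>lborel)"
  proof (rule nn_integral_cong_AE)
    have J: "J z s = ennreal (1 / s) * indicator {norm z / 2<..<norm z} s" for z s
      by (simp add: J_def indicator_def)
    \<comment> \<open>At the origin the interval of admissible s is empty and the weight is 0
      instead of ln 2; a single point is null.\<close>
    have "AE z in lborel. z \<noteq> (0::'a)" by (rule AE_lborel_singleton)
    then show "AE z in lborel. (\<integral>\<^sup>+s. F z * J z s \<partial>lborel) = F z * ennreal (ln 2)"
      by eventually_elim (simp add: J nn_integral_cmult nn_integral_inverse_Ioo)
  qed
  finally show ?thesis by (simp add: nn_integral_multc mult.commute)
qed

text \<open>Apply \<open>nn_integral_rays\<close> to h(|z|) restricted to the unit ball. Rescaling s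
  by |x| turns every ray integral into |x|^(-N) times one and the same one-dimensional integral, so
  \<open>c\<close> is the integral of |x|^(-N) over the annulus divided by ln 2, that is, the area
  of the unit sphere. Later arguments rely on \<open>c\<close> being positive and independent of
  \<open>h\<close>.\<close>

lemma nn_integral_radial:
  obtains c where "0 < c"
    "\<And>h. h \<in> borel_measurable borel \<Longrightarrow> (\<integral>\<^sup>+x\<in>ball (0::'a::euclidean_space) 1. h (norm x) \<partial>lborel)
      = ennreal c * (\<integral>\<^sup>+s\<in>{0..1}. ennreal (s ^ (DIM('a) - 1)) * h s \<partial>lborel)"
proof -
  let ?A = "{x::'a. 1 < norm x \<and> norm x < 2}"
  let ?W = "\<integral>\<^sup>+x\<in>?A. ennreal (1 / norm x ^ DIM('a)) \<partial>lborel"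
  have [measurable]: "?A \<in> sets borel" by measurable
  have opA: "open ?A"
    by (intro open_Collect_conj open_Collect_less continuous_intros)
  obtain b :: 'a where b: "b \<in> Basis" using nonempty_Basis by blast
  then have "(3/2) *\<^sub>R b \<in> ?A" by simp
  then have "?A \<noteq> {}" by blast
  \<comment> \<open>A nonempty open set is not null. As |x|^(-N) lies between 2^(-N) and 1 on the
    annulus, \<open>?W\<close> is both positive and finite.\<close>
  then have A0: "emeasure lborel ?A \<noteq> 0"
    using opA open_not_negligible[of ?A] null_sets_completionI[of ?A lborel]
    by (auto simp: negligible_iff_null_sets null_sets_def)
  have Afin: "emeasure lborel ?A < \<infinity>"
    by (rule emeasure_bounded_finite) (auto intro!: boundedI[of _ 2])
  have "?W \<le> (\<integral>\<^sup>+x. indicator ?A x \<partial>lborel)"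
  proof (intro nn_integral_mono)
    fix x :: 'a
    have "1 / norm x ^ DIM('a) \<le> 1" if "1 < norm x"
      using one_le_power[of "norm x" "DIM('a)"] that by (intro divide_le_eq_1_pos[THEN iffD2]) linarith+
    then show "ennreal (1 / norm x ^ DIM('a)) * indicator ?A x \<le> indicator ?A x"
      by (simp add: indicator_def)
  qed
  with Afin have Wfin: "?W < \<infinity>" by (simp add: le_less_trans)
  have "ennreal (1 / 2 ^ DIM('a)) * emeasure lborel ?A = (\<integral>\<^sup>+x. ennreal (1 / 2 ^ DIM('a)) * indicator ?A x \<partial>lborel)"
    by (subst nn_integral_cmult) auto
  also have "\<dots> \<le> ?W"
  proof (intro nn_integral_mono)
    fix x :: 'a
    have "1 / 2 ^ DIM('a) \<le> 1 / norm x ^ DIM('a)" if "1 < norm x" "norm x < 2"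
      using that by (intro frac_le power_mono zero_less_power) linarith+
    then show "ennreal (1 / 2 ^ DIM('a)) * indicator ?A x \<le> ennreal (1 / norm x ^ DIM('a)) * indicator ?A x"
      by (auto simp: indicator_def)
  qed
  finally have "0 < ?W" using A0
    by (metis (no_types, lifting) divide_pos_pos ennreal_eq_0_iff gr_zeroI le_zero_eq mult_eq_0_iff not_le zero_less_numeral zero_less_one zero_less_power)
  then obtain w where w: "0 < w" "?W = ennreal w"
    using Wfin by (cases ?W) (auto simp: top_unique)
  show thesis
  proof (rule that[of "w / ln 2"])
    show "0 < w / ln 2" using w by simp
    fix h :: "real \<Rightarrow> ennreal" assume [measurable]: "h \<in> borel_measurable borel"
    let ?J = "\<integral>\<^sup>+s\<in>{0..1}. ennreal (s ^ (DIM('a) - 1)) * h s \<partial>lborel"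
    have inner: "(\<integral>\<^sup>+s\<in>{0<..}. ennreal (s ^ (DIM('a) - 1)) * (h (norm (s *\<^sub>R x)) * indicator (ball 0 1) (s *\<^sub>R x)) \<partial>lborel)
        = ennreal (1 / norm x ^ DIM('a)) * ?J" if "x \<noteq> 0" for x :: 'a
    proof -
      define r where "r = norm x"
      have r: "0 < r" using that by (simp add: r_def)
      have "r ^ DIM('a) = r * r ^ (DIM('a) - 1)"
        by (metis DIM_positive Suc_pred' power_Suc)
      then have rr: "1 / r ^ DIM('a) * (r * (r * s) ^ (DIM('a) - 1)) = s ^ (DIM('a) - 1)" for s
        using r by (simp add: power_mult_distrib)
      have "?J = ennreal \<bar>r\<bar> * (\<integral>\<^sup>+s. ennreal ((0 + r * s) ^ (DIM('a) - 1)) * h (0 + r * s) * indicator {0..1} (0 + r * s) \<partial>lborel)"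
        by (rule nn_integral_real_affine) (use r in auto)
      also have "\<dots> = (\<integral>\<^sup>+s. ennreal r * (ennreal ((r * s) ^ (DIM('a) - 1)) * h (r * s) * indicator {0..1} (r * s)) \<partial>lborel)"
        using r by (subst nn_integral_cmult) auto
      finally have "ennreal (1 / r ^ DIM('a)) * ?J = (\<integral>\<^sup>+s. ennreal (1 / r ^ DIM('a)) *
          (ennreal r * (ennreal ((r * s) ^ (DIM('a) - 1)) * h (r * s) * indicator {0..1} (r * s))) \<partial>lborel)"
        by (simp add: nn_integral_cmult)
      also have "\<dots> = (\<integral>\<^sup>+s\<in>{0<..}. ennreal (s ^ (DIM('a) - 1)) * (h (norm (s *\<^sub>R x)) * indicator (ball 0 1) (s *\<^sub>R x)) \<partial>lborel)"
      proof (rule nn_integral_cong_AE)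
        \<comment> \<open>The closed interval on the left and the open conditions s > 0, r s < 1 on
          the right differ only at s = 0 and s = 1/r.\<close>
        have "AE s in lborel. s \<noteq> (0::real)" "AE s in lborel. s \<noteq> 1 / r"
          by (rule AE_lborel_singleton)+
        then show "AE s in lborel. ennreal (1 / r ^ DIM('a)) *
          (ennreal r * (ennreal ((r * s) ^ (DIM('a) - 1)) * h (r * s) * indicator {0..1} (r * s)))
          = ennreal (s ^ (DIM('a) - 1)) * (h (norm (s *\<^sub>R x)) * indicator (ball 0 1) (s *\<^sub>R x)) * indicator {0<..} s"
        proof eventually_elim
          case (elim s)
          have "r * s = 1 \<longleftrightarrow> s = 1 / r" using r by (auto simp: field_simps)
          with elim have ne: "r * s \<noteq> 1" by simp
          show ?case
          proof (cases "0 < s \<and> r * s < 1")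
            case True
            then have "ennreal (1 / r ^ DIM('a)) * (ennreal r * ennreal ((r * s) ^ (DIM('a) - 1)))
                = ennreal (s ^ (DIM('a) - 1))"
              using r rr[of s] by (simp add: ennreal_mult[symmetric])
            moreover have "norm (s *\<^sub>R x) = r * s" using True by (simp add: r_def)
            ultimately show ?thesis
              using True r by (simp add: indicator_def mult.assoc[symmetric] mult.commute[of s r])
          next
            case False
            have "\<not> (0 \<le> r * s \<and> r * s \<le> 1)"
              using False ne elim r by (auto simp: zero_le_mult_iff)
            moreover have "\<not> (0 < s \<and> norm (s *\<^sub>R x) < 1)"
              using False by (auto simp: r_def mult.commute)
            ultimately show ?thesis by (auto simp: indicator_def)
          qed
        qed
      qed
      finally show ?thesis by (simp add: r_def)
    qed
    have "ennreal (ln 2) * (\<integral>\<^sup>+x\<in>ball (0::'a) 1. h (norm x) \<partial>lborel)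
      = (\<integral>\<^sup>+x\<in>?A. (\<integral>\<^sup>+s\<in>{0<..}. ennreal (s ^ (DIM('a) - 1)) *
          (h (norm (s *\<^sub>R x)) * indicator (ball 0 1) (s *\<^sub>R x)) \<partial>lborel) \<partial>lborel)"
      by (rule nn_integral_rays[symmetric])
        (intro borel_measurable_times_ennreal borel_measurable_indicator; simp)
    also have "\<dots> = (\<integral>\<^sup>+x\<in>?A. ennreal (1 / norm x ^ DIM('a)) * ?J \<partial>lborel)"
    proof (rule nn_integral_cong)
      fix x :: 'a
      show "(\<integral>\<^sup>+s\<in>{0<..}. ennreal (s ^ (DIM('a) - 1)) *
          (h (norm (s *\<^sub>R x)) * indicator (ball 0 1) (s *\<^sub>R x)) \<partial>lborel) * indicator ?A x
          = ennreal (1 / norm x ^ DIM('a)) * ?J * indicator ?A x"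
      proof (cases "x \<in> ?A")
        case True
        then have "x \<noteq> 0" by auto
        then show ?thesis by (subst inner) auto
      qed simp
    qed
    also have "\<dots> = (\<integral>\<^sup>+x. ?J * (ennreal (1 / norm x ^ DIM('a)) * indicator ?A x) \<partial>lborel)"
      by (intro nn_integral_cong) (simp only: mult_ac)
    also have "\<dots> = ?J * ennreal w"
      by (subst nn_integral_cmult) (simp_all add: w(2))
    finally have e: "ennreal (ln 2) * (\<integral>\<^sup>+x\<in>ball (0::'a) 1. h (norm x) \<partial>lborel) = ?J * ennreal w" .
    have "(\<integral>\<^sup>+x\<in>ball (0::'a) 1. h (norm x) \<partial>lborel)
        = ennreal (1 / ln 2) * (ennreal (ln 2) * (\<integral>\<^sup>+x\<in>ball (0::'a) 1. h (norm x) \<partial>lborel))"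
      by (simp add: mult.assoc[symmetric] ennreal_mult[symmetric])
    also have "\<dots> = (ennreal (1 / ln 2) * ennreal w) * ?J"
      unfolding e by (simp only: mult_ac)
    also have "ennreal (1 / ln 2) * ennreal w = ennreal (w / ln 2)"
      using w by (simp add: ennreal_mult[symmetric])
    finally show "(\<integral>\<^sup>+x\<in>ball (0::'a) 1. h (norm x) \<partial>lborel) = ennreal (w / ln 2) * ?J" .
  qed
qed

section \<open>One-dimensional inequalities\<close>

lemma nn_integral_continuous_Icc:
  fixes f :: "real \<Rightarrow> real"
  assumes "continuous_on {a..b} f" "\<And>x. x \<in> {a..b} \<Longrightarrow> 0 \<le> f x"
  shows "(\<integral>\<^sup>+x\<in>{a..b}. ennreal (f x) \<partial>lborel) = ennreal (integral {a..b} f)"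
proof -
  have i: "set_integrable lborel {a..b} f"
    using assms by (intro borel_integrable_atLeastAtMost') auto
  have "(\<integral>\<^sup>+x\<in>{a..b}. ennreal (f x) \<partial>lborel) = (\<integral>\<^sup>+x. ennreal (indicator {a..b} x *\<^sub>R f x) \<partial>lborel)"
    by (intro nn_integral_cong) (auto simp: indicator_def)
  also have "\<dots> = ennreal (LINT x:{a..b}|lborel. f x)"
    using i assms(2) unfolding set_integrable_def set_lebesgue_integral_def
    by (intro nn_integral_eq_integral) (auto simp: indicator_def)
  finally show ?thesis using set_borel_integral_eq_integral(2)[OF i] by simp
qed

text \<open>Away from 0 this is the chain rule. At 0 the difference quotient is bounded by
  |h|^(p-1), which tends to 0 because \<open>1 < p\<close>.\<close>

lemma has_real_derivative_abs_powr:
  fixes x p :: real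
  assumes "1 < p"
  shows "((\<lambda>x. \<bar>x\<bar> powr p) has_real_derivative p * \<bar>x\<bar> powr (p - 1) * sgn x) (at x)"
proof (cases x "0::real" rule: linorder_cases)
  case equal
  have "((\<lambda>h::real. \<bar>h\<bar> powr (p - 1)) \<longlongrightarrow> \<bar>0\<bar> powr (p - 1)) (at 0)"
    using assms by (intro tendsto_intros) auto
  then have "((\<lambda>h::real. \<bar>h\<bar> powr (p - 1)) \<longlongrightarrow> 0) (at 0)"
    by simp
  then have "((\<lambda>h::real. \<bar>h\<bar> powr p / h) \<longlongrightarrow> 0) (at 0)"
  proof (rule Lim_null_comparison[rotated])
    show "\<forall>\<^sub>F h::real in at 0. norm (\<bar>h\<bar> powr p / h) \<le> \<bar>h\<bar> powr (p - 1)"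
      by (auto simp: eventually_at_filter powr_diff)
  qed
  then show ?thesis using equal by (simp add: DERIV_def)
next
  case greater
  have "((\<lambda>x. x powr p) has_real_derivative p * x powr (p - 1)) (at x)"
    using greater by (rule has_real_derivative_powr)
  then have "((\<lambda>x. \<bar>x\<bar> powr p) has_real_derivative p * x powr (p - 1)) (at x)"
    by (rule has_field_derivative_transform_within_open[where S = "{0<..}"]) (use greater in auto)
  then show ?thesis using greater by simp
next
  case less
  have "((\<lambda>x. (- x) powr p) has_real_derivative p * (- x) powr (p - 1) * - 1) (at x)"
    by (rule DERIV_fun_powr[where g = uminus, simplified]) (use less in \<open>auto intro!: derivative_eq_intros\<close>)
  then have "((\<lambda>x. \<bar>x\<bar> powr p) has_real_derivative p * (- x) powr (p - 1) * - 1) (at x)"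
    by (rule has_field_derivative_transform_within_open[where S = "{..<0}"]) (use less in auto)
  then show ?thesis using less by simp
qed

text \<open>Young's inequality with weights (p-1)/p and 1/p, applied to t a^p and t^(1-p) b^p: the
  powers of \<open>t\<close> cancel in the product, so \<open>t\<close> is a free parameter to be
  optimised.\<close>

lemma Young_powr:
  fixes a b p t :: real
  assumes "1 < p" "0 < t" "0 \<le> a" "0 \<le> b"
  shows "p * a powr (p - 1) * b \<le> (p - 1) * t * a powr p + t powr (1 - p) * b powr p"
proof (cases "a = 0 \<or> b = 0")
  case True
  then show ?thesis using assms by auto
next
  case False
  let ?X = "t * a powr p" and ?Y = "t powr (1 - p) * b powr p"
  have "?X powr ((p - 1) / p) * ?Y powr (1 / p) \<le> (p - 1) / p * ?X + 1 / p * ?Y"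
    using assms False by (intro Youngs_inequality_0) (auto simp: field_simps)
  moreover have "?X powr ((p - 1) / p) * ?Y powr (1 / p)
      = (t powr ((p - 1) / p) * t powr ((1 - p) / p)) * (a powr (p - 1) * b)"
    using assms by (simp add: powr_mult powr_powr mult_ac)
  moreover have "t powr ((p - 1) / p) * t powr ((1 - p) / p) = 1"
    using assms by (simp add: powr_add[symmetric] add_divide_distrib[symmetric])
  ultimately have "p * (a powr (p - 1) * b) \<le> p * ((p - 1) / p * ?X + 1 / p * ?Y)"
    using assms by (intro mult_left_mono) auto
  moreover have "p * ((p - 1) / p * X + 1 / p * Y) = (p - 1) * X + Y" for X Y :: real
    using assms by (simp add: field_simps)
  ultimately show ?thesis by (simp add: mult.assoc)
qed

text \<open>
  Integrate the derivative of \<open>\<bar>g\<bar>\<^sup>p s\<^bsup>m-p\<^esup>\<close>, which is nonnegative at \<open>1\<close> and vanishes near \<open>0\<close>, and bound it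
  pointwise by Young's inequality.
\<close>

lemma Hardy_1d:
  fixes g g' :: "real \<Rightarrow> real" and p \<delta> :: real and m :: nat
  assumes m: "1 \<le> m" "real m < p"
    and der: "\<And>s. (g has_real_derivative g' s) (at s)"
    and cont: "continuous_on UNIV g'"
    and \<delta>: "0 < \<delta>" "\<And>s. \<bar>s\<bar> < \<delta> \<Longrightarrow> g s = 0"
  shows "((p - m) / p) powr p * integral {0..1} (\<lambda>s. s ^ (m - 1) * \<bar>g s\<bar> powr p)
    \<le> integral {0..1} (\<lambda>s. s ^ (m - 1) * \<bar>g' s\<bar> powr p)"
proof -
  \<comment> \<open>This value of the Young parameter is optimal: it maximises (p - m - (p-1) t)
    t^(p-1), and the maximum is t^p. It also makes the coefficients of the term in |g|^p collapse to
    (p-1) t - p t = -t.\<close>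
  define t where "t = (p - m) / p"
  define \<Phi> where "\<Phi> s = \<bar>g s\<bar> powr p * s powr (m - p)" for s
  define \<Phi>' where "\<Phi>' s = p * \<bar>g s\<bar> powr (p - 1) * sgn (g s) * g' s * s powr (m - p)
      + \<bar>g s\<bar> powr p * ((m - p) * s powr (m - p - 1))" for s
  have p: "1 < p" and t: "0 < t" and pt: "p * t = p - m"
    using m by (auto simp: t_def)
  have contg: "continuous_on A g" for A
    by (meson DERIV_isCont continuous_at_imp_continuous_on der)
  \<comment> \<open>The factor s^(m-p) is singular at 0, but \<open>g\<close> vanishes near 0, so
    \<open>\<Phi>\<close> is locally 0 there and the fundamental theorem applies on all of
    [0,1].\<close>
  have \<Phi>_der: "(\<Phi> has_real_derivative \<Phi>' s) (at s)" if "0 \<le> s" for s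
  proof (cases "s < \<delta>")
    case True
    have "(\<Phi> has_real_derivative 0) (at s)"
      by (rule has_field_derivative_transform_within_open[where f = "\<lambda>_. 0" and S = "{-\<delta><..<\<delta>}"])
        (use True that \<delta> p in \<open>auto simp: \<Phi>_def\<close>)
    moreover have "\<Phi>' s = 0" using True that \<delta>(2)[of s] p by (simp add: \<Phi>'_def)
    ultimately show ?thesis by simp
  next
    case False
    then have s: "0 < s" using \<delta> by simp
    have 1: "((\<lambda>s. s powr (m - p)) has_real_derivative (m - p) * s powr (m - p - 1)) (at s)"
      using s by (rule has_real_derivative_powr)
    have 2: "((\<lambda>s. \<bar>g s\<bar> powr p) has_real_derivative p * \<bar>g s\<bar> powr (p - 1) * sgn (g s) * g' s) (at s)"
      using DERIV_chain2[OF has_real_derivative_abs_powr[OF p] der] .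
    show ?thesis
      unfolding \<Phi>_def[abs_def] \<Phi>'_def using DERIV_mult[OF 2 1] by (simp add: mult_ac add.commute)
  qed
  then have FTC: "(\<Phi>' has_integral \<Phi> 1 - \<Phi> 0) {0..1}"
    by (intro fundamental_theorem_of_calculus)
      (auto simp: has_real_derivative_iff_has_vector_derivative[symmetric]
        intro: has_field_derivative_at_within)
  have int: "(\<lambda>s. s ^ (m - 1) * \<bar>g s\<bar> powr p) integrable_on {0..1}"
    "(\<lambda>s. s ^ (m - 1) * \<bar>g' s\<bar> powr p) integrable_on {0..1}"
    using p contg continuous_on_subset[OF cont]
    by (auto intro!: integrable_continuous_real continuous_intros continuous_on_powr')
  have int': "(\<lambda>s. t * (s ^ (m - 1) * \<bar>g s\<bar> powr p)) integrable_on {0..1}"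
    "(\<lambda>s. t powr (1 - p) * (s ^ (m - 1) * \<bar>g' s\<bar> powr p)) integrable_on {0..1}"
    by (intro integrable_on_mult_right int)+
  have "t * (s ^ (m - 1) * \<bar>g s\<bar> powr p) \<le> t powr (1 - p) * (s ^ (m - 1) * \<bar>g' s\<bar> powr p) - \<Phi>' s"
    if s: "s \<in> {0..1}" for s
  proof (cases "s = 0")
    case True
    then show ?thesis using \<delta>(2)[of s] \<delta>(1) p t by (simp add: \<Phi>'_def)
  next
    case False
    with s have s: "0 < s" "s \<le> 1" by auto
    \<comment> \<open>Hardy's inequality controls |g|/s rather than |g|. The pointwise bound is
      proved for this quotient, which dominates |g| because s is at most 1.\<close>
    define a where "a = \<bar>g s\<bar> / s"
    have sm: "s ^ (m - 1) = s powr (real m - 1)"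
      using s m powr_realpow[of s "m - 1"] by (simp add: of_nat_diff)
    have sm': "s * s ^ (m - Suc 0) = s powr m"
      using s m powr_realpow[of s m] by (cases m) auto
    have a1: "a powr (p - 1) * s ^ (m - 1) = \<bar>g s\<bar> powr (p - 1) * s powr (m - p)"
      using s by (simp add: a_def sm powr_divide powr_minus_divide[symmetric] powr_diff powr_add field_simps sm')
    have a0: "a powr p * s ^ (m - 1) = \<bar>g s\<bar> powr p * s powr (m - p - 1)"
      using s by (simp add: a_def sm powr_divide powr_minus_divide[symmetric] powr_diff powr_add field_simps sm')
    have "sgn (g s) * g' s \<le> \<bar>g' s\<bar>"
      by (auto simp: sgn_if)
    then have "(p * \<bar>g s\<bar> powr (p - 1) * s powr (m - p)) * (sgn (g s) * g' s)
        \<le> (p * \<bar>g s\<bar> powr (p - 1) * s powr (m - p)) * \<bar>g' s\<bar>"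
      using p by (intro mult_left_mono) auto
    also have "\<dots> = s ^ (m - 1) * (p * a powr (p - 1) * \<bar>g' s\<bar>)"
      using a1 by (simp add: mult_ac)
    also have "\<dots> \<le> s ^ (m - 1) * ((p - 1) * t * a powr p + t powr (1 - p) * \<bar>g' s\<bar> powr p)"
      using s p t Young_powr[of p t a "\<bar>g' s\<bar>"] by (intro mult_left_mono) (auto simp: a_def)
    finally have "\<Phi>' s \<le> s ^ (m - 1) * ((p - 1) * t * a powr p + t powr (1 - p) * \<bar>g' s\<bar> powr p)
        + (m - p) * (a powr p * s ^ (m - 1))"
      unfolding \<Phi>'_def a0 by (simp add: mult_ac)
    also have "(m - p) = - (p * t)" using pt by simp
    also have "s ^ (m - 1) * ((p - 1) * t * a powr p + t powr (1 - p) * \<bar>g' s\<bar> powr p)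
        + - (p * t) * (a powr p * s ^ (m - 1))
        = t powr (1 - p) * (s ^ (m - 1) * \<bar>g' s\<bar> powr p) - t * (s ^ (m - 1) * a powr p)"
      by (simp add: algebra_simps)
    finally have "t * (s ^ (m - 1) * a powr p) \<le> t powr (1 - p) * (s ^ (m - 1) * \<bar>g' s\<bar> powr p) - \<Phi>' s"
      by simp
    moreover have "\<bar>g s\<bar> \<le> a"
      using s by (simp add: a_def pos_le_divide_eq mult_left_le)
    then have "t * (s ^ (m - 1) * \<bar>g s\<bar> powr p) \<le> t * (s ^ (m - 1) * a powr p)"
      using t s p by (intro mult_left_mono powr_mono2) auto
    ultimately show ?thesis by simp
  qed
  then have "integral {0..1} (\<lambda>s. t * (s ^ (m - 1) * \<bar>g s\<bar> powr p))
      \<le> integral {0..1} (\<lambda>s. t powr (1 - p) * (s ^ (m - 1) * \<bar>g' s\<bar> powr p) - \<Phi>' s)"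
    using int' FTC by (intro integral_le integrable_diff) auto
  also have "\<dots> = t powr (1 - p) * integral {0..1} (\<lambda>s. s ^ (m - 1) * \<bar>g' s\<bar> powr p) - (\<Phi> 1 - \<Phi> 0)"
    using int' FTC by (subst integral_diff) (auto simp: integral_unique)
  also have "\<dots> \<le> t powr (1 - p) * integral {0..1} (\<lambda>s. s ^ (m - 1) * \<bar>g' s\<bar> powr p)"
    using \<delta>(2)[of 0] \<delta>(1) p by (simp add: \<Phi>_def)
  finally have "t * integral {0..1} (\<lambda>s. s ^ (m - 1) * \<bar>g s\<bar> powr p)
      \<le> t powr (1 - p) * integral {0..1} (\<lambda>s. s ^ (m - 1) * \<bar>g' s\<bar> powr p)"
    by simp
  then have "t powr (p - 1) * (t * integral {0..1} (\<lambda>s. s ^ (m - 1) * \<bar>g s\<bar> powr p))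
      \<le> t powr (p - 1) * (t powr (1 - p) * integral {0..1} (\<lambda>s. s ^ (m - 1) * \<bar>g' s\<bar> powr p))"
    by (intro mult_left_mono) auto
  moreover have "t powr (p - 1) * t = t powr p" "t powr (p - 1) * t powr (1 - p) = 1"
    using t by (auto simp: powr_diff powr_add[symmetric])
  ultimately show ?thesis
    unfolding t_def[symmetric] by (simp only: mult.assoc[symmetric] mult_1_left)
qed

section \<open>Gradients, and radial competitors for the punctured constants\<close>

lemma grad_eqI:
  assumes D: "(u has_derivative (\<lambda>h. h \<bullet> D)) (at x)"
  shows "grad u x = D"
proof -
  have "E = D" if "GDERIV u x :> E" for E
  proof -
    have "(\<lambda>h. h \<bullet> E) = (\<lambda>h. h \<bullet> D)"
      using that D unfolding gderiv_def by (rule has_derivative_unique)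
    then have "(E - D) \<bullet> E = (E - D) \<bullet> D" by metis
    then have "(E - D) \<bullet> (E - D) = 0" by (simp add: inner_diff_right)
    then show ?thesis by simp
  qed
  moreover have "GDERIV u x :> D"
    using D by (simp only: gderiv_def)
  ultimately have "(THE E. GDERIV u x :> E) = D"
    by (rule the_equality[rotated])
  moreover have "u differentiable (at x)" using D by (rule differentiableI)
  ultimately show ?thesis by (simp add: grad_def)
qed

text \<open>Riesz representation in coordinates: the values of the differential on
  \<open>Basis\<close> are the components of a representing vector, which \<open>grad_eqI\<close>
  identifies with the gradient.\<close>

lemma has_derivative_grad:
  fixes u :: "'a::euclidean_space \<Rightarrow> real"
  assumes "u differentiable (at x)"
  shows "(u has_derivative (\<lambda>h. h \<bullet> grad u x)) (at x)"
proof -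
  obtain f' where f': "(u has_derivative f') (at x)"
    using assms by (auto simp: differentiable_def)
  interpret bounded_linear f' using f' by (rule has_derivative_bounded_linear)
  define D where "D = (\<Sum>b\<in>Basis. f' b *\<^sub>R b)"
  have "f' h = h \<bullet> D" for h
  proof -
    have "f' h = f' (\<Sum>b\<in>Basis. (h \<bullet> b) *\<^sub>R b)"
      by (simp add: euclidean_representation)
    also have "\<dots> = (\<Sum>b\<in>Basis. (h \<bullet> b) * f' b)"
      by (simp add: sum scaleR)
    finally show ?thesis by (simp add: D_def inner_sum_right mult.commute)
  qed
  then have "f' = (\<lambda>h. h \<bullet> D)" by (rule ext)
  with f' have "(u has_derivative (\<lambda>h. h \<bullet> D)) (at x)" by simp
  then show ?thesis by (simp add: grad_eqI)
qed

text \<open>Passes from the integrals in the definitions to nonnegative integrals over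
  \<open>lborel\<close>, where Tonelli and substitution are available. A divergent integral causes
  no exception, since both sides then default to 0.\<close>

lemma LINT_lebesgue_on_eq_enn2real:
  fixes f :: "'a::euclidean_space \<Rightarrow> real"
  assumes [measurable]: "f \<in> borel_measurable borel" "S \<in> sets borel" and "\<And>x. x \<in> S \<Longrightarrow> 0 \<le> f x"
  shows "(LINT x|lebesgue_on S. f x) = enn2real (\<integral>\<^sup>+x\<in>S. ennreal (f x) \<partial>lborel)"
proof -
  have S: "S \<inter> space lebesgue \<in> sets lebesgue"
    using assms(2) by simp
  have "f \<in> borel_measurable lebesgue"
    using assms(1) by (simp add: measurable_completion)
  then have "(LINT x|lebesgue_on S. f x) = enn2real (\<integral>\<^sup>+x. ennreal (f x) \<partial>lebesgue_on S)"
    using assms(3) S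
    by (intro integral_eq_nn_integral measurable_restrict_space1 AE_I2) (auto simp: space_restrict_space)
  also have "(\<integral>\<^sup>+x. ennreal (f x) \<partial>lebesgue_on S) = (\<integral>\<^sup>+x\<in>S. ennreal (f x) \<partial>lborel)"
    using S by (simp add: nn_integral_restrict_space nn_integral_completion)
  finally show ?thesis .
qed

text \<open>Any admissible function bounds the infimum from above. It also gives the nonnegativity,
  which for an infimum of reals has to exclude the empty set.\<close>

lemma
  fixes u :: "'a::euclidean_space \<Rightarrow> real"
  assumes u: "L-lipschitz_on (cball 0 1) u" "Lp_norm q (ball 0 1) u = 1" "u 0 = 0"
  shows punctured_const_le:
      "punctured_const p q TYPE('a) \<le> (LINT x|lebesgue_on (ball 0 1). norm (grad u x) powr p)"
    and punctured_const_nonneg: "0 \<le> punctured_const p q TYPE('a)"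
proof -
  let ?S = "{LINT x|lebesgue_on (ball (0::'a) 1). norm (grad u x) powr p | u.
            (\<exists>L. L-lipschitz_on (cball 0 1) u) \<and> Lp_norm q (ball 0 1) u = 1 \<and> u 0 = 0}"
  have mem: "(LINT x|lebesgue_on (ball 0 1). norm (grad u x) powr p) \<in> ?S"
    by (rule CollectI, rule exI[of _ u]) (use u in simp, rule exI)
  have nonneg: "0 \<le> s" if "s \<in> ?S" for s
    using that by (elim CollectE exE conjE) simp
  show "punctured_const p q TYPE('a) \<le> (LINT x|lebesgue_on (ball 0 1). norm (grad u x) powr p)"
    unfolding punctured_const_def by (rule cInf_lower[OF mem bdd_belowI[OF nonneg]])
  show "0 \<le> punctured_const p q TYPE('a)"
    unfolding punctured_const_def by (rule cInf_greatest[OF _ nonneg]) (use mem in blast)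
qed

text \<open>One \<open>c\<close> serves all \<open>f\<close> and \<open>p\<close>; hence it cancels
  when the integral of a radial function is compared with that of its gradient.\<close>

lemma LINT_ball_radial:
  obtains c where "0 < c"
    "\<And>f p. continuous_on UNIV f \<Longrightarrow> 0 < p \<Longrightarrow>
      (LINT x|lebesgue_on (ball (0::'a::euclidean_space) 1). \<bar>f (norm x) :: real\<bar> powr p)
        = c * integral {0..1} (\<lambda>s. s ^ (DIM('a) - 1) * \<bar>f s\<bar> powr p)"
proof -
  obtain c where c: "0 < c"
    "\<And>h. h \<in> borel_measurable borel \<Longrightarrow> (\<integral>\<^sup>+x\<in>ball (0::'a) 1. h (norm x) \<partial>lborel)
      = ennreal c * (\<integral>\<^sup>+s\<in>{0..1}. ennreal (s ^ (DIM('a) - 1)) * h s \<partial>lborel)"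
    by (rule nn_integral_radial) blast
  show thesis
  proof (rule that[OF c(1)])
    fix f :: "real \<Rightarrow> real" and p :: real assume f: "continuous_on UNIV f" and p: "0 < p"
    let ?F = "\<lambda>s. s ^ (DIM('a) - 1) * \<bar>f s\<bar> powr p"
    have [measurable]: "f \<in> borel_measurable borel"
      using f by (rule borel_measurable_continuous_onI)
    have cF: "continuous_on {0..1} ?F"
      using p continuous_on_subset[OF f] by (auto intro!: continuous_intros continuous_on_powr')
    have I: "0 \<le> integral {0..1} ?F"
      by (rule integral_nonneg[OF integrable_continuous_real[OF cF]]) simp
    have "(LINT x|lebesgue_on (ball (0::'a) 1). \<bar>f (norm x)\<bar> powr p)
        = enn2real (\<integral>\<^sup>+x\<in>ball (0::'a) 1. ennreal (\<bar>f (norm x)\<bar> powr p) \<partial>lborel)"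
      by (intro LINT_lebesgue_on_eq_enn2real) auto
    also have "(\<integral>\<^sup>+x\<in>ball (0::'a) 1. ennreal (\<bar>f (norm x)\<bar> powr p) \<partial>lborel)
        = ennreal c * (\<integral>\<^sup>+s\<in>{0..1}. ennreal (s ^ (DIM('a) - 1)) * ennreal (\<bar>f s\<bar> powr p) \<partial>lborel)"
      by (rule c) measurable
    also have "(\<integral>\<^sup>+s\<in>{0..1}. ennreal (s ^ (DIM('a) - 1)) * ennreal (\<bar>f s\<bar> powr p) \<partial>lborel)
        = (\<integral>\<^sup>+s\<in>{0..1}. ennreal (?F s) \<partial>lborel)"
      by (intro nn_integral_cong) (auto simp: indicator_def ennreal_mult)
    also have "\<dots> = ennreal (integral {0..1} ?F)"
      using cF by (rule nn_integral_continuous_Icc) auto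
    also have "ennreal c * \<dots> = ennreal (c * integral {0..1} ?F)"
      using c(1) I by (subst ennreal_mult) auto
    finally show "(LINT x|lebesgue_on (ball (0::'a) 1). \<bar>f (norm x)\<bar> powr p) = c * integral {0..1} ?F"
      using c(1) I by simp
  qed
qed

text \<open>The competitor showing that the infimum runs over a nonempty set is a multiple of the
  norm, normalised in L^p by polar coordinates.\<close>

lemma punctured_const_p_nonneg:
  assumes p: "0 < p"
  shows "0 \<le> punctured_const p (ereal p) TYPE('a::euclidean_space)"
proof -
  obtain c where c: "0 < c"
    "\<And>f p. continuous_on UNIV f \<Longrightarrow> 0 < p \<Longrightarrow>
      (LINT x|lebesgue_on (ball (0::'a::euclidean_space) 1). \<bar>f (norm x) :: real\<bar> powr p)
        = c * integral {0..1} (\<lambda>s. s ^ (DIM('a) - 1) * \<bar>f s\<bar> powr p)"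
    by (rule LINT_ball_radial) blast
  \<comment> \<open>The exponent of the radial integrand of |x|^p, namely p + N - 1.\<close>
  define a where "a = p + (real DIM('a) - 1)"
  have a: "0 < a" using p DIM_positive[where 'a = 'a] unfolding a_def by linarith
  have "s ^ (DIM('a) - 1) * \<bar>s\<bar> powr p = s powr a" if "s \<in> {0..1}" for s :: real
  proof (cases "s = 0")
    case False
    then have "s ^ (DIM('a) - 1) = s powr real (DIM('a) - 1)"
      using that by (subst powr_realpow) auto
    moreover have "real (DIM('a) - 1) = real DIM('a) - 1"
      by (simp add: of_nat_diff Suc_leI)
    ultimately show ?thesis
      using that by (simp only: a_def powr_add) simp
  qed (use a p in auto)
  then have "integral {0..1} (\<lambda>s. s ^ (DIM('a) - 1) * \<bar>s\<bar> powr p) = integral {0..1} (\<lambda>s. s powr a)"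
    by (intro integral_cong)
  also have "\<dots> = 1 / (a + 1)"
    using has_integral_powr_from_0[of a 1] a by (simp add: integral_unique)
  finally have J: "(LINT x|lebesgue_on (ball (0::'a) 1). norm x powr p) = c / (a + 1)"
    using c(2)[of "\<lambda>s. s" p] p by simp
  define J where "J = c / (a + 1)"
  define k where "k = J powr (- (1 / p))"
  have "0 < J" using c(1) a by (simp add: J_def)
  then have k: "0 < k" "k powr p = 1 / J"
    using p unfolding k_def powr_powr by (auto simp: powr_minus_divide)
  have lip: "k-lipschitz_on (cball 0 1) (\<lambda>x::'a. k * norm x)"
  proof (rule lipschitz_onI)
    show "dist (k * norm x) (k * norm y) \<le> k * dist x y" for x y :: 'a
      using k norm_triangle_ineq3[of x y]
      by (simp add: dist_norm right_diff_distrib[symmetric] abs_mult)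
  qed (use k in auto)
  have "(LINT x|lebesgue_on (ball (0::'a) 1). norm (k * norm x) powr p) = 1"
    using k \<open>0 < J\<close> by (simp add: abs_mult powr_mult J J_def[symmetric])
  then have "Lp_norm (ereal p) (ball (0::'a) 1) (\<lambda>x. k * norm x) = 1"
    by (simp add: Lp_norm_def)
  from punctured_const_nonneg[OF lip this] show ?thesis by simp
qed

text \<open>The competitor is the radial function k g(|x|), whose gradient has length k |g'(|x|)|.
  With \<open>k\<close> chosen so that its L^p norm on the ball is 1, the sphere area
  \<open>c\<close> cancels and the quotient of the two one-dimensional integrals remains.\<close>

lemma punctured_const_1d:
  fixes g g' :: "real \<Rightarrow> real" and p \<delta> :: real
  assumes p: "1 \<le> p"
    and der: "\<And>s. (g has_real_derivative g' s) (at s)"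
    and cont: "continuous_on UNIV g'"
    and \<delta>: "0 < \<delta>" "\<And>s. \<bar>s\<bar> < \<delta> \<Longrightarrow> g s = 0"
  shows "punctured_const p (ereal p) TYPE('a::euclidean_space)
      * integral {0..1} (\<lambda>s. s ^ (DIM('a) - 1) * \<bar>g s\<bar> powr p)
    \<le> integral {0..1} (\<lambda>s. s ^ (DIM('a) - 1) * \<bar>g' s\<bar> powr p)"
    (is "?\<Lambda> * ?I \<le> ?I'")
proof -
  have contg: "continuous_on UNIV g"
    by (meson DERIV_isCont continuous_at_imp_continuous_on der)
  have [measurable]: "g \<in> borel_measurable borel" "g' \<in> borel_measurable borel"
    using contg cont by (auto intro: borel_measurable_continuous_onI)
  have cI: "continuous_on {0..1} (\<lambda>s. s ^ (DIM('a) - 1) * \<bar>f s\<bar> powr p)"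
    if "continuous_on UNIV f" for f :: "real \<Rightarrow> real"
    using p continuous_on_subset[OF that] by (auto intro!: continuous_intros continuous_on_powr')
  have I0: "0 \<le> ?I" "0 \<le> ?I'"
    using cI[OF contg] cI[OF cont] by (auto intro!: integral_nonneg integrable_continuous_real)
  obtain c where c: "0 < c"
    "\<And>f p. continuous_on UNIV f \<Longrightarrow> 0 < p \<Longrightarrow>
      (LINT x|lebesgue_on (ball (0::'a::euclidean_space) 1). \<bar>f (norm x) :: real\<bar> powr p)
        = c * integral {0..1} (\<lambda>s. s ^ (DIM('a) - 1) * \<bar>f s\<bar> powr p)"
    by (rule LINT_ball_radial) blast
  have radial: "(LINT x|lebesgue_on (ball (0::'a) 1). k powr p * \<bar>f (norm x)\<bar> powr p)
      = k powr p * (c * integral {0..1} (\<lambda>s. s ^ (DIM('a) - 1) * \<bar>f s\<bar> powr p))"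
    if "continuous_on UNIV f" for f and k :: real
    using c(2)[OF that] p by simp
  show ?thesis
  proof (cases "?I = 0")
    case True
    then show ?thesis using I0 by simp
  next
    case False
    with I0 have I: "0 < ?I" by simp
    define k where "k = (c * ?I) powr (- (1 / p))"
    have k: "0 < k" "k powr p = 1 / (c * ?I)"
      using I c(1) p unfolding k_def powr_powr by (auto simp: powr_minus_divide)
    define v where "v x = k * g (norm x)" for x :: 'a
    \<comment> \<open>Needed for the formula for |grad v| at the origin, where the norm is not
      differentiable but \<open>v\<close> is locally 0.\<close>
    have g'0: "g' 0 = 0"
    proof (rule DERIV_unique[OF der])
      show "(g has_real_derivative 0) (at 0)"
        by (rule has_field_derivative_transform_within_open[where f = "\<lambda>_. 0" and S = "{-\<delta><..<\<delta>}"])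
          (use \<delta> in auto)
    qed
    have grad_v: "norm (grad v x) = k * \<bar>g' (norm x)\<bar>" for x
    proof (cases "x = 0")
      case True
      have "(v has_derivative (\<lambda>h. h \<bullet> 0)) (at x)"
        by (rule has_derivative_transform_within_open[of "\<lambda>_. 0" _ _ _ "ball 0 \<delta>"])
          (use True \<delta> in \<open>auto simp: v_def\<close>)
      then show ?thesis using True by (simp add: grad_eqI g'0)
    next
      case False
      have "(v has_derivative (\<lambda>h. h \<bullet> ((k * g' (norm x)) *\<^sub>R sgn x))) (at x)"
        unfolding v_def
        using has_derivative_compose[OF has_derivative_norm[OF False] der[unfolded has_field_derivative_def, of "norm x"]]
        by (auto intro!: derivative_eq_intros simp: mult_ac)
      from grad_eqI[OF this] show ?thesis
        using False k by (simp add: norm_sgn abs_mult)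
    qed
    have "bounded (g' ` {0..1})"
      by (intro compact_imp_bounded compact_continuous_image continuous_on_subset[OF cont]) auto
    then obtain B where B: "0 < B" "\<And>s. s \<in> {0..1} \<Longrightarrow> \<bar>g' s\<bar> \<le> B"
      unfolding bounded_pos by auto
    have g_lip: "\<bar>g s - g t\<bar> \<le> B * \<bar>s - t\<bar>" if "s \<in> {0..1}" "t \<in> {0..1}" for s t
      using field_differentiable_bound[of "{0..1}" g g' B s t] B that
        has_field_derivative_at_within[OF der] by auto
    have lip: "(k * B)-lipschitz_on (cball 0 1) v"
    proof (rule lipschitz_onI)
      fix x y :: 'a assume "x \<in> cball 0 1" "y \<in> cball 0 1"
      then have "\<bar>g (norm x) - g (norm y)\<bar> \<le> B * \<bar>norm x - norm y\<bar>"
        by (intro g_lip) auto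
      also have "\<dots> \<le> B * norm (x - y)"
        using B norm_triangle_ineq3[of x y] by (intro mult_left_mono) auto
      finally show "dist (v x) (v y) \<le> k * B * dist x y"
        using k by (simp add: v_def dist_norm right_diff_distrib[symmetric] abs_mult mult.assoc)
    qed (use k B in auto)
    have "norm (v x) powr p = k powr p * \<bar>g (norm x)\<bar> powr p" for x
      using k by (simp add: v_def abs_mult powr_mult)
    then have "(LINT x|lebesgue_on (ball (0::'a) 1). norm (v x) powr p) = k powr p * (c * ?I)"
      by (simp only: radial[OF contg])
    then have "(LINT x|lebesgue_on (ball (0::'a) 1). norm (v x) powr p) = 1"
      using c(1) I k(2) by simp
    then have norm1: "Lp_norm (ereal p) (ball 0 1) v = 1"
      by (simp add: Lp_norm_def)
    have "v 0 = 0" using \<delta> by (simp add: v_def)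
    have "?\<Lambda> \<le> (LINT x|lebesgue_on (ball 0 1). norm (grad v x) powr p)"
      by (rule punctured_const_le) fact+
    also have "\<dots> = (LINT x|lebesgue_on (ball (0::'a) 1). k powr p * \<bar>g' (norm x)\<bar> powr p)"
      using k by (simp only: grad_v powr_mult)
    also have "\<dots> = k powr p * (c * ?I')"
      by (rule radial[OF cont])
    also have "\<dots> = ?I' / ?I"
      using c(1) k(2) by simp
    finally show ?thesis using I by (simp add: field_simps)
  qed
qed

text \<open>The first entry of the maximum follows from \<open>punctured_const_1d\<close>: its
  divisor is at least 1 and may be dropped, the constant being nonnegative. The second entry is
  \<open>Hardy_1d\<close> with m = N.\<close>

lemma beta_1d:
  fixes g g' :: "real \<Rightarrow> real" and p \<delta> :: real
  assumes p: "real DIM('a) < p"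
    and der: "\<And>s. (g has_real_derivative g' s) (at s)"
    and cont: "continuous_on UNIV g'"
    and \<delta>: "0 < \<delta>" "\<And>s. \<bar>s\<bar> < \<delta> \<Longrightarrow> g s = 0"
  shows "beta p TYPE('a::euclidean_space)
      * integral {0..1} (\<lambda>s. s ^ (DIM('a) - 1) * \<bar>g s\<bar> powr p)
    \<le> integral {0..1} (\<lambda>s. s ^ (DIM('a) - 1) * \<bar>g' s\<bar> powr p)"
    (is "_ * ?I \<le> ?I'")
proof -
  let ?\<Lambda> = "punctured_const p (ereal p) TYPE('a)"
  let ?d = "(sqrt DIM('a) + 1) powr p"
  have N: "1 \<le> DIM('a)" by (simp add: Suc_leI)
  with p have p1: "1 < p" by linarith
  have contg: "continuous_on {0..1} g"
    by (meson DERIV_isCont continuous_at_imp_continuous_on der)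
  have cI: "continuous_on {0..1} (\<lambda>s. s ^ (DIM('a) - 1) * \<bar>g s\<bar> powr p)"
    using p1 contg by (auto intro!: continuous_intros continuous_on_powr')
  have I: "0 \<le> ?I"
    using integral_nonneg[OF integrable_continuous_real[OF cI]] by simp
  have "1 \<le> sqrt DIM('a) + 1" by simp
  then have "1 \<le> ?d" using p1 by (intro ge_one_powr_ge_zero) auto
  then have "?\<Lambda> / ?d \<le> ?\<Lambda> / 1"
    using punctured_const_p_nonneg[of p, where 'a = 'a] p1
    by (intro divide_left_mono) auto
  then have "?\<Lambda> / ?d * ?I \<le> ?\<Lambda> * ?I"
    using I by (intro mult_right_mono) auto
  also have "\<dots> \<le> ?I'"
    using p1 der cont \<delta> by (intro punctured_const_1d) auto
  finally have "?\<Lambda> / ?d * ?I \<le> ?I'" .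
  moreover have "((p - DIM('a)) / p) powr p * ?I \<le> ?I'"
    by (rule Hardy_1d) fact+
  ultimately show ?thesis
    by (auto simp: beta_def Let_def max_def)
qed

section \<open>The case \<open>q = p\<close>\<close>

lemma beta_pos:
  assumes "real DIM('a::euclidean_space) < p"
  shows "0 < beta p TYPE('a)"
proof -
  have "0 < p" using assms by (rule le_less_trans[OF of_nat_0_le_iff])
  then have "0 < ((p - DIM('a)) / p) powr p" using assms by simp
  then show ?thesis unfolding beta_def Let_def by (rule less_le_trans) simp
qed

text \<open>Substituting T s for s brings the segment (0,T] to (0,1], and s^k ds contributes
  T^(k+1). This power depends on the ray but is common to the integrals of the function and of its
  gradient.\<close>

lemma nn_integral_ray_segment:
  fixes \<phi> :: "real \<Rightarrow> real"
  assumes [measurable]: "\<phi> \<in> borel_measurable borel" "S \<in> sets borel"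
    and \<phi>: "\<And>s. 0 \<le> \<phi> s" and T: "0 < T" and S: "\<And>s. 0 < s \<Longrightarrow> s \<in> S \<longleftrightarrow> s \<le> T"
  shows "(\<integral>\<^sup>+s\<in>{0<..}. ennreal (s ^ k) * (ennreal (\<phi> s) * indicator S s) \<partial>lborel)
    = ennreal (T ^ (k + 1)) * (\<integral>\<^sup>+s\<in>{0..1}. ennreal (s ^ k * \<phi> (T * s)) \<partial>lborel)"
proof -
  have "(\<integral>\<^sup>+s\<in>{0<..}. ennreal (s ^ k) * (ennreal (\<phi> s) * indicator S s) \<partial>lborel)
      = ennreal \<bar>T\<bar> * (\<integral>\<^sup>+s. ennreal ((0 + T * s) ^ k) * (ennreal (\<phi> (0 + T * s)) * indicator S (0 + T * s))
          * indicator {0<..} (0 + T * s) \<partial>lborel)"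
    using T by (intro nn_integral_real_affine) auto
  also have "\<dots> = ennreal T * (\<integral>\<^sup>+s. ennreal (T ^ k) * (ennreal (s ^ k * \<phi> (T * s)) * indicator {0..1} s) \<partial>lborel)"
  proof -
    have "AE s in lborel. ennreal ((0 + T * s) ^ k) * (ennreal (\<phi> (0 + T * s)) * indicator S (0 + T * s))
          * indicator {0<..} (0 + T * s)
        = ennreal (T ^ k) * (ennreal (s ^ k * \<phi> (T * s)) * indicator {0..1} s)"
      using AE_lborel_singleton[of "0::real"]
    proof eventually_elim
      case (elim s)
      show ?case
      proof (cases "0 < s")
        case True
        then have "T * s \<in> S \<longleftrightarrow> s \<le> 1" using S[of "T * s"] T by simp
        then show ?thesis
          using True T \<phi>[of "T * s"]
          by (auto simp: indicator_def power_mult_distrib ennreal_mult[symmetric] mult_ac)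
      next
        case False
        then show ?thesis using elim T by (auto simp: indicator_def zero_less_mult_iff)
      qed
    qed
    then show ?thesis using T by (simp add: nn_integral_cong_AE)
  qed
  also have "\<dots> = (ennreal T * ennreal (T ^ k)) * (\<integral>\<^sup>+s\<in>{0..1}. ennreal (s ^ k * \<phi> (T * s)) \<partial>lborel)"
    by (subst nn_integral_cmult) (simp_all add: mult.assoc)
  also have "ennreal T * ennreal (T ^ k) = ennreal (T ^ (k + 1))"
    using T by (simp add: ennreal_mult[symmetric])
  finally show ?thesis .
qed

text \<open>The ray from \<open>y\<close> in direction \<open>x\<close> meets the star-shaped set in
  a segment whose length T |x| is at most \<open>R\<close>. Apply \<open>beta_1d\<close> to g(s) =
  u(y + T s x). By Cauchy-Schwarz |g'| is at most T |x| |grad u|, hence at most R |grad u|, which is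
  the source of the factor R^p.\<close>

lemma star_Poincare_ray:
  fixes u :: "'a::euclidean_space \<Rightarrow> real"
  assumes p: "real DIM('a) < p"
    and K: "closed K" "K \<subseteq> cball y R"
    and star: "\<And>x t. x \<in> K \<Longrightarrow> 0 \<le> t \<Longrightarrow> t \<le> 1 \<Longrightarrow> y + t *\<^sub>R (x - y) \<in> K"
    and u: "\<And>x. u differentiable (at x)" "continuous_on UNIV (grad u)"
    and \<delta>: "0 < \<delta>" "\<And>x. dist x y < \<delta> \<Longrightarrow> u x = 0"
    and x: "x \<noteq> 0"
  shows "ennreal (beta p TYPE('a)) * (\<integral>\<^sup>+s\<in>{0<..}. ennreal (s ^ (DIM('a) - 1)) *
        (ennreal (\<bar>u (y + s *\<^sub>R x)\<bar> powr p) * indicator K (y + s *\<^sub>R x)) \<partial>lborel)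
    \<le> ennreal (R powr p) * (\<integral>\<^sup>+s\<in>{0<..}. ennreal (s ^ (DIM('a) - 1)) *
        (ennreal (norm (grad u (y + s *\<^sub>R x)) powr p) * indicator K (y + s *\<^sub>R x)) \<partial>lborel)"
    (is "_ * ?L \<le> _ * ?R")
proof -
  let ?b = "beta p TYPE('a)"
  have N: "1 \<le> DIM('a)" by (simp add: Suc_leI)
  with p have p1: "1 < p" by linarith
  define S where "S = {s. 0 \<le> s \<and> y + s *\<^sub>R x \<in> K}"
  have contu: "continuous_on UNIV u"
    using u(1) by (simp add: continuous_at_imp_continuous_on differentiable_imp_continuous_within)
  have "closed ((\<lambda>s. y + s *\<^sub>R x) -` K)"
    by (rule continuous_closed_vimage[OF K(1)]) (intro continuous_intros)
  moreover have "S = {0..} \<inter> (\<lambda>s. y + s *\<^sub>R x) -` K"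
    by (auto simp: S_def)
  ultimately have clS: "closed S"
    by (simp add: closed_Int)
  have bnd: "s * norm x \<le> R" if "s \<in> S" for s
  proof -
    have "y + s *\<^sub>R x \<in> cball y R" using that K(2) by (auto simp: S_def)
    then show ?thesis using that by (simp add: S_def dist_norm)
  qed
  have bdd: "bdd_above S"
  proof (rule bdd_aboveI)
    show "s \<le> R / norm x" if "s \<in> S" for s
      using bnd[OF that] x by (simp add: field_simps)
  qed
  have ind: "indicator K (y + s *\<^sub>R x) * indicator {0<..} s = (indicator S s * indicator {0<..} s :: ennreal)" for s
    by (auto simp: S_def indicator_def)
  \<comment> \<open>A ray without points of \<open>K\<close> beyond its origin contributes nothing
    to the left-hand side.\<close>
  have "?L = 0" if "\<not> (\<exists>s\<in>S. 0 < s)"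
  proof -
    have "ennreal (s ^ (DIM('a) - 1)) * (ennreal (\<bar>u (y + s *\<^sub>R x)\<bar> powr p) * indicator K (y + s *\<^sub>R x))
        * indicator {0<..} s = 0" for s
      using that by (auto simp: S_def indicator_def)
    then show ?thesis by (simp only: nn_integral_const mult_zero_left)
  qed
  moreover have ?thesis if ex: "\<exists>s\<in>S. 0 < s"
  proof -
    \<comment> \<open>Closedness makes the supremum an element of \<open>S\<close>; star-shapedness
      then puts every smaller positive parameter into \<open>S\<close>.\<close>
    define T where "T = Sup S"
    have T_in: "T \<in> S"
      unfolding T_def using ex bdd clS by (intro closed_contains_Sup) auto
    have T_ub: "s \<le> T" if "s \<in> S" for s
      unfolding T_def using that bdd by (rule cSup_upper)
    from ex T_ub have T: "0 < T" by force
    have S_iff: "s \<in> S \<longleftrightarrow> s \<le> T" if "0 < s" for s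
    proof
      assume "s \<le> T"
      have "y + (s / T) *\<^sub>R ((y + T *\<^sub>R x) - y) \<in> K"
        by (rule star) (use T_in T that \<open>s \<le> T\<close> in \<open>auto simp: S_def\<close>)
      then show "s \<in> S" using T that by (simp add: S_def)
    qed (rule T_ub)
    have [measurable]: "S \<in> sets borel" using clS by simp
    have c1: "continuous_on UNIV (\<lambda>s. u (y + s *\<^sub>R x))"
      by (rule continuous_on_compose2[OF contu]) (auto intro!: continuous_intros)
    have c2: "continuous_on UNIV (\<lambda>s. grad u (y + s *\<^sub>R x))"
      by (rule continuous_on_compose2[OF u(2)]) (auto intro!: continuous_intros)
    define g where "g s = u (y + (T * s) *\<^sub>R x)" for s
    define g' where "g' s = (T *\<^sub>R x) \<bullet> grad u (y + (T * s) *\<^sub>R x)" for s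
    have der: "(g has_real_derivative g' s) (at s)" for s
    proof -
      have 1: "((\<lambda>s. y + (T * s) *\<^sub>R x) has_derivative (\<lambda>h. (T * h) *\<^sub>R x)) (at s)"
        by (auto intro!: derivative_eq_intros)
      have "(g has_derivative (\<lambda>h. ((T * h) *\<^sub>R x) \<bullet> grad u (y + (T * s) *\<^sub>R x))) (at s)"
        unfolding g_def using has_derivative_compose[OF 1 has_derivative_grad[OF u(1)]] .
      moreover have "(\<lambda>h. ((T * h) *\<^sub>R x) \<bullet> grad u (y + (T * s) *\<^sub>R x)) = (*) (g' s)"
        by (rule ext) (simp add: g'_def)
      ultimately show ?thesis by (simp add: has_field_derivative_def)
    qed
    have cg': "continuous_on UNIV g'"
      unfolding g'_def using continuous_on_compose2[OF c2, of UNIV "\<lambda>s. T * s"]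
      by (auto intro!: continuous_intros)
    have cg: "continuous_on UNIV g"
      unfolding g_def using continuous_on_compose2[OF c1, of UNIV "\<lambda>s. T * s"]
      by (auto intro!: continuous_intros)
    \<comment> \<open>The radius \<open>\<delta>\<close> on which \<open>u\<close> vanishes,
      measured in the parameter of \<open>g\<close>, whose path has speed T |x|.\<close>
    define \<epsilon> where "\<epsilon> = \<delta> / (T * norm x)"
    have \<epsilon>: "0 < \<epsilon>" using \<delta>(1) T x by (simp add: \<epsilon>_def)
    have g0: "g s = 0" if "\<bar>s\<bar> < \<epsilon>" for s
      unfolding g_def
    proof (rule \<delta>(2))
      have "\<bar>s\<bar> * (T * norm x) < \<delta>" using that T x by (simp add: \<epsilon>_def pos_less_divide_eq)
      then show "dist (y + (T * s) *\<^sub>R x) y < \<delta>"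
        using T by (simp add: dist_norm abs_mult mult_ac)
    qed
    let ?I = "integral {0..1} (\<lambda>s. s ^ (DIM('a) - 1) * \<bar>g s\<bar> powr p)"
    let ?I' = "integral {0..1} (\<lambda>s. s ^ (DIM('a) - 1) * \<bar>g' s\<bar> powr p)"
    have cI: "continuous_on {0..1} (\<lambda>s. s ^ (DIM('a) - 1) * \<bar>f s\<bar> powr p)"
      if "continuous_on UNIV f" for f :: "real \<Rightarrow> real"
      using p1 continuous_on_subset[OF that] by (auto intro!: continuous_intros continuous_on_powr')
    have main: "?b * ?I \<le> ?I'"
      by (rule beta_1d[OF p der cg' \<epsilon> g0])
    have "?L = (\<integral>\<^sup>+s\<in>{0<..}. ennreal (s ^ (DIM('a) - 1)) *
        (ennreal (\<bar>u (y + s *\<^sub>R x)\<bar> powr p) * indicator S s) \<partial>lborel)"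
      using ind by (intro nn_integral_cong) (simp only: mult.assoc)
    also have "\<dots> = ennreal (T ^ (DIM('a) - 1 + 1)) *
        (\<integral>\<^sup>+s\<in>{0..1}. ennreal (s ^ (DIM('a) - 1) * \<bar>g s\<bar> powr p) \<partial>lborel)"
      unfolding g_def
      by (rule nn_integral_ray_segment)
        (use T S_iff borel_measurable_continuous_onI[OF c1] in auto)
    also have "(\<integral>\<^sup>+s\<in>{0..1}. ennreal (s ^ (DIM('a) - 1) * \<bar>g s\<bar> powr p) \<partial>lborel) = ennreal ?I"
      using cI[OF cg] by (rule nn_integral_continuous_Icc) auto
    finally have "ennreal ?b * ?L = ennreal (T ^ (DIM('a) - 1 + 1)) * ennreal (?b * ?I)"
      using beta_pos[OF p] integral_nonneg[OF integrable_continuous_real[OF cI[OF cg]]]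
      by (simp add: ennreal_mult mult_ac)
    also have "\<dots> \<le> ennreal (T ^ (DIM('a) - 1 + 1)) * ennreal ?I'"
      using main by (intro mult_left_mono ennreal_leI) auto
    also have "ennreal ?I' = (\<integral>\<^sup>+s\<in>{0..1}. ennreal (s ^ (DIM('a) - 1) * \<bar>g' s\<bar> powr p) \<partial>lborel)"
      using cI[OF cg'] by (rule nn_integral_continuous_Icc[symmetric]) auto
    also have "\<dots> \<le> (\<integral>\<^sup>+s. ennreal (R powr p) *
        (ennreal (s ^ (DIM('a) - 1) * norm (grad u (y + (T * s) *\<^sub>R x)) powr p) * indicator {0..1} s) \<partial>lborel)"
    proof (rule nn_integral_mono)
      fix s :: real
      let ?n = "norm (grad u (y + (T * s) *\<^sub>R x))"
      have "0 \<le> T * norm x" using T by simp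
      with bnd[OF T_in] have R: "T * norm x \<le> R" "0 \<le> R" by linarith+
      have "\<bar>g' s\<bar> \<le> norm (T *\<^sub>R x) * ?n"
        unfolding g'_def by (rule Cauchy_Schwarz_ineq2)
      also have "\<dots> \<le> R * ?n"
        using R T by (intro mult_right_mono) auto
      finally have "\<bar>g' s\<bar> powr p \<le> (R * ?n) powr p"
        using p1 by (intro powr_mono2) auto
      also have "\<dots> = R powr p * ?n powr p"
        using R by (simp add: powr_mult)
      finally have le: "\<bar>g' s\<bar> powr p \<le> R powr p * ?n powr p" .
      have "s ^ (DIM('a) - 1) * \<bar>g' s\<bar> powr p \<le> R powr p * (s ^ (DIM('a) - 1) * ?n powr p)"
        if "0 \<le> s" using mult_left_mono[OF le zero_le_power[OF that, of "DIM('a) - 1"]] by (simp only: mult.left_commute)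
      then show "ennreal (s ^ (DIM('a) - 1) * \<bar>g' s\<bar> powr p) * indicator {0..1} s
          \<le> ennreal (R powr p) * (ennreal (s ^ (DIM('a) - 1) * ?n powr p) * indicator {0..1} s)"
        by (auto simp: indicator_def ennreal_mult[symmetric] intro!: ennreal_leI)
    qed
    also have "\<dots> = ennreal (R powr p) * (\<integral>\<^sup>+s\<in>{0..1}. ennreal (s ^ (DIM('a) - 1) * norm (grad u (y + (T * s) *\<^sub>R x)) powr p) \<partial>lborel)"
    proof (rule nn_integral_cmult)
      have [measurable]: "(\<lambda>s. grad u (y + s *\<^sub>R x)) \<in> borel_measurable borel"
        using c2 by (rule borel_measurable_continuous_onI)
      show "(\<lambda>s. ennreal (s ^ (DIM('a) - 1) * norm (grad u (y + (T * s) *\<^sub>R x)) powr p) * indicator {0..1} s)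
          \<in> borel_measurable lborel" by measurable
    qed
    finally have "ennreal ?b * ?L \<le> ennreal (R powr p) * (ennreal (T ^ (DIM('a) - 1 + 1)) *
        (\<integral>\<^sup>+s\<in>{0..1}. ennreal (s ^ (DIM('a) - 1) * norm (grad u (y + (T * s) *\<^sub>R x)) powr p) \<partial>lborel))"
      by (simp only: mult_left_mono mult.left_commute zero_le)
    also have "ennreal (T ^ (DIM('a) - 1 + 1)) *
        (\<integral>\<^sup>+s\<in>{0..1}. ennreal (s ^ (DIM('a) - 1) * norm (grad u (y + (T * s) *\<^sub>R x)) powr p) \<partial>lborel)
        = (\<integral>\<^sup>+s\<in>{0<..}. ennreal (s ^ (DIM('a) - 1)) *
        (ennreal (norm (grad u (y + s *\<^sub>R x)) powr p) * indicator S s) \<partial>lborel)"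
      by (rule nn_integral_ray_segment[symmetric])
        (use T S_iff borel_measurable_continuous_onI[OF c2] in auto)
    also have "\<dots> = ?R"
      using ind by (intro nn_integral_cong) (simp only: mult.assoc)
    finally show ?thesis .
  qed
  ultimately show ?thesis by (cases "\<exists>s\<in>S. 0 < s") auto
qed

text \<open>With \<open>y\<close> translated to the origin, integrate the ray inequality over the
  annulus of directions. By \<open>nn_integral_rays\<close> both sides acquire the same factor ln 2,
  which cancels.\<close>

lemma star_Poincare:
  fixes u :: "'a::euclidean_space \<Rightarrow> real"
  assumes p: "real DIM('a) < p"
    and K: "closed K" "K \<subseteq> cball y R"
    and star: "\<And>x t. x \<in> K \<Longrightarrow> 0 \<le> t \<Longrightarrow> t \<le> 1 \<Longrightarrow> y + t *\<^sub>R (x - y) \<in> K"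
    and u: "\<And>x. u differentiable (at x)" "continuous_on UNIV (grad u)"
    and \<delta>: "0 < \<delta>" "\<And>x. dist x y < \<delta> \<Longrightarrow> u x = 0"
  shows "ennreal (beta p TYPE('a)) * (\<integral>\<^sup>+x\<in>K. ennreal (\<bar>u x\<bar> powr p) \<partial>lborel)
    \<le> ennreal (R powr p) * (\<integral>\<^sup>+x\<in>K. ennreal (norm (grad u x) powr p) \<partial>lborel)"
proof -
  have [measurable]: "K \<in> sets borel" using K(1) by simp
  have contu: "continuous_on UNIV u"
    using u(1) by (simp add: continuous_at_imp_continuous_on differentiable_imp_continuous_within)
  have [measurable]: "u \<in> borel_measurable borel" "grad u \<in> borel_measurable borel"
    using contu u(2) by (auto intro: borel_measurable_continuous_onI)
  let ?A = "{x::'a. 1 < norm x \<and> norm x < 2}"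
  have [measurable]: "?A \<in> sets borel" by measurable
  define F where "F x = ennreal (\<bar>u (y + x)\<bar> powr p) * indicator K (y + x)" for x
  define G where "G x = ennreal (norm (grad u (y + x)) powr p) * indicator K (y + x)" for x
  have [measurable]: "F \<in> borel_measurable borel" "G \<in> borel_measurable borel"
    unfolding F_def[abs_def] G_def[abs_def] by measurable
  define J where "J H x = (\<integral>\<^sup>+s\<in>{0<..}. ennreal (s ^ (DIM('a) - 1)) * H (s *\<^sub>R x) \<partial>lborel)"
    for H :: "'a \<Rightarrow> ennreal" and x
  have J_meas: "J H \<in> borel_measurable borel" if [measurable]: "H \<in> borel_measurable borel" for H
    unfolding J_def[abs_def] by measurable
  have rays: "(\<integral>\<^sup>+x. c * (J H x * indicator ?A x) \<partial>lborel) = ennreal (ln 2) * (c * (\<integral>\<^sup>+z. H z \<partial>lborel))"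
    if [measurable]: "H \<in> borel_measurable borel" for H c
  proof -
    have [measurable]: "J H \<in> borel_measurable borel" using that by (rule J_meas)
    have "(\<integral>\<^sup>+x. c * (J H x * indicator ?A x) \<partial>lborel) = c * (\<integral>\<^sup>+x. J H x * indicator ?A x \<partial>lborel)"
      by (rule nn_integral_cmult) measurable
    also have "(\<integral>\<^sup>+x. J H x * indicator ?A x \<partial>lborel) = ennreal (ln 2) * (\<integral>\<^sup>+z. H z \<partial>lborel)"
      unfolding J_def by (rule nn_integral_rays[OF that])
    finally show ?thesis by (simp only: mult.left_commute)
  qed
  have "(\<integral>\<^sup>+x. ennreal (beta p TYPE('a)) * (J F x * indicator ?A x) \<partial>lborel)
      \<le> (\<integral>\<^sup>+x. ennreal (R powr p) * (J G x * indicator ?A x) \<partial>lborel)"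
  proof (rule nn_integral_mono)
    fix x :: 'a
    show "ennreal (beta p TYPE('a)) * (J F x * indicator ?A x) \<le> ennreal (R powr p) * (J G x * indicator ?A x)"
    proof (cases "x \<in> ?A")
      case True
      then have "x \<noteq> 0" by auto
      then have "ennreal (beta p TYPE('a)) * J F x \<le> ennreal (R powr p) * J G x"
        unfolding J_def F_def G_def by (intro star_Poincare_ray[OF p K star u \<delta>])
      then show ?thesis using True by simp
    qed simp
  qed
  then have "ennreal (beta p TYPE('a)) * (\<integral>\<^sup>+z. F z \<partial>lborel) \<le> ennreal (R powr p) * (\<integral>\<^sup>+z. G z \<partial>lborel)"
    by (subst (asm) (1 2) rays) (simp_all add: ennreal_mult_le_mult_iff)
  moreover have "(\<integral>\<^sup>+x\<in>K. ennreal (\<bar>u x\<bar> powr p) \<partial>lborel) = (\<integral>\<^sup>+z. F z \<partial>lborel)"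
    using nn_integral_lborel_scale[of "\<lambda>x. ennreal (\<bar>u x\<bar> powr p) * indicator K x" 1 y]
    by (simp add: F_def)
  moreover have "(\<integral>\<^sup>+x\<in>K. ennreal (norm (grad u x) powr p) \<partial>lborel) = (\<integral>\<^sup>+z. G z \<partial>lborel)"
    using nn_integral_lborel_scale[of "\<lambda>x. ennreal (norm (grad u x) powr p) * indicator K x" 1 y]
    by (simp add: G_def)
  ultimately show ?thesis by simp
qed

text \<open>The points equidistant from \<open>y\<close> and \<open>z\<close> lie on a hyperplane
  with normal z - y. This is why overlaps of distinct Voronoi cells can be ignored.\<close>

lemma AE_dist_neq:
  fixes y z :: "'a::euclidean_space"
  assumes "y \<noteq> z"
  shows "AE x in lborel. dist x y \<noteq> dist x z"
proof -
  let ?H = "{x. (2 *\<^sub>R (z - y)) \<bullet> x = z \<bullet> z - y \<bullet> y}"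
  have H: "x \<in> ?H" if "dist x y = dist x z" for x
  proof -
    have "(x - y) \<bullet> (x - y) = (x - z) \<bullet> (x - z)"
      using that by (simp add: dist_norm norm_eq)
    then show ?thesis by (simp add: inner_diff_left inner_diff_right inner_commute)
  qed
  have "negligible ?H" by (rule negligible_hyperplane) (use assms in auto)
  moreover have "?H \<in> sets borel" by (simp add: closed_hyperplane)
  ultimately have "?H \<in> null_sets lborel"
    by (simp add: negligible_iff_null_sets null_sets_completion_iff)
  then show ?thesis by (rule AE_I') (use H in auto)
qed

text \<open>
  The Voronoi cells of \<open>F\<close>, cut off at distance \<open>R\<close>, are star-shaped about their centres, where
  \<open>u\<close> vanishes.
\<close>

lemma Poincare_near_finite_set:
  fixes u :: "'a::euclidean_space \<Rightarrow> real"
  assumes p: "real DIM('a) < p"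
    and u: "\<And>x. u differentiable (at x)" "continuous_on UNIV (grad u)"
    and F: "finite F" "\<And>x. u x \<noteq> 0 \<Longrightarrow> \<exists>y\<in>F. dist x y \<le> R"
      "\<And>y. y \<in> F \<Longrightarrow> \<exists>\<delta>>0. \<forall>x. dist x y < \<delta> \<longrightarrow> u x = 0"
  shows "ennreal (beta p TYPE('a)) * (\<integral>\<^sup>+x. ennreal (\<bar>u x\<bar> powr p) \<partial>lborel)
    \<le> ennreal (R powr p) * (\<integral>\<^sup>+x. ennreal (norm (grad u x) powr p) \<partial>lborel)"
proof -
  have contu: "continuous_on UNIV u"
    using u(1) by (simp add: continuous_at_imp_continuous_on differentiable_imp_continuous_within)
  have [measurable]: "u \<in> borel_measurable borel" "grad u \<in> borel_measurable borel"
    using contu u(2) by (auto intro: borel_measurable_continuous_onI)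
  define V where "V y = {x. dist x y \<le> R} \<inter> (\<Inter>z\<in>F. {x. dist x y \<le> dist x z})" for y
  have clV: "closed (V y)" for y
    unfolding V_def by (intro closed_Int closed_INT ballI closed_Collect_le continuous_intros)
  have [measurable]: "V y \<in> sets borel" for y
    using clV by simp
  have star: "y + t *\<^sub>R (x - y) \<in> V y" if x: "x \<in> V y" and t: "0 \<le> t" "t \<le> 1" for x y t
  proof -
    let ?w = "y + t *\<^sub>R (x - y)"
    have w: "dist ?w y = t * dist x y" using t by (simp add: dist_norm)
    have "x - ?w = (1 - t) *\<^sub>R (x - y)" by (simp add: algebra_simps)
    then have w': "dist x ?w = (1 - t) * dist x y" using t by (simp add: dist_norm)
    have "t * dist x y \<le> dist x y" using t by (simp add: mult_left_le_one_le)
    then have "dist ?w y \<le> R" using x w by (simp add: V_def)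
    \<comment> \<open>Moving from \<open>x\<close> towards \<open>y\<close> by a distance d shortens
      the distance to \<open>y\<close> by exactly d and that to \<open>z\<close> by at most
      d.\<close>
    moreover have "dist ?w y \<le> dist ?w z" if "z \<in> F" for z
    proof -
      have "dist x y \<le> dist x z" using x that by (auto simp: V_def)
      also have "\<dots> \<le> dist x ?w + dist ?w z" by (rule dist_triangle)
      finally show ?thesis using w w' by (simp add: algebra_simps)
    qed
    ultimately show ?thesis by (simp add: V_def)
  qed
  have cell: "ennreal (beta p TYPE('a)) * (\<integral>\<^sup>+x\<in>V y. ennreal (\<bar>u x\<bar> powr p) \<partial>lborel)
    \<le> ennreal (R powr p) * (\<integral>\<^sup>+x\<in>V y. ennreal (norm (grad u x) powr p) \<partial>lborel)" if y: "y \<in> F" for y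
  proof -
    obtain \<delta> where "0 < \<delta>" "\<And>x. dist x y < \<delta> \<Longrightarrow> u x = 0" using F(3)[OF y] by blast
    moreover have "V y \<subseteq> cball y R" by (auto simp: V_def dist_commute)
    ultimately show ?thesis using p clV star u by (intro star_Poincare)
  qed
  have "(\<integral>\<^sup>+x. ennreal (\<bar>u x\<bar> powr p) \<partial>lborel)
      \<le> (\<integral>\<^sup>+x. (\<Sum>y\<in>F. ennreal (\<bar>u x\<bar> powr p) * indicator (V y) x) \<partial>lborel)"
  proof (rule nn_integral_mono)
    fix x
    show "ennreal (\<bar>u x\<bar> powr p) \<le> (\<Sum>y\<in>F. ennreal (\<bar>u x\<bar> powr p) * indicator (V y) x)"
    proof (cases "u x = 0")
      case False
      then obtain y0 where y0: "y0 \<in> F" "dist x y0 \<le> R" using F(2) by blast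
      obtain y where y: "y \<in> F" "\<And>z. z \<in> F \<Longrightarrow> dist x y \<le> dist x z"
        using ex_min_if_finite[of "dist x ` F"] F(1) y0(1) by (fastforce simp: not_less)
      have "dist x y \<le> R" using y(2)[OF y0(1)] y0(2) by simp
      then have "x \<in> V y" using y by (simp add: V_def)
      then have "ennreal (\<bar>u x\<bar> powr p) = ennreal (\<bar>u x\<bar> powr p) * indicator (V y) x" by simp
      also have "\<dots> \<le> (\<Sum>y\<in>F. ennreal (\<bar>u x\<bar> powr p) * indicator (V y) x)"
        using F(1) y(1) by (intro member_le_sum) auto
      finally show ?thesis .
    qed (use p in simp)
  qed
  also have "\<dots> = (\<Sum>y\<in>F. \<integral>\<^sup>+x\<in>V y. ennreal (\<bar>u x\<bar> powr p) \<partial>lborel)"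
    by (rule nn_integral_sum) measurable
  finally have "ennreal (beta p TYPE('a)) * (\<integral>\<^sup>+x. ennreal (\<bar>u x\<bar> powr p) \<partial>lborel)
      \<le> ennreal (beta p TYPE('a)) * (\<Sum>y\<in>F. \<integral>\<^sup>+x\<in>V y. ennreal (\<bar>u x\<bar> powr p) \<partial>lborel)"
    by (intro mult_left_mono) auto
  also have "\<dots> \<le> (\<Sum>y\<in>F. ennreal (R powr p) * (\<integral>\<^sup>+x\<in>V y. ennreal (norm (grad u x) powr p) \<partial>lborel))"
    unfolding sum_distrib_left by (intro sum_mono cell)
  also have "\<dots> = ennreal (R powr p) * (\<Sum>y\<in>F. \<integral>\<^sup>+x\<in>V y. ennreal (norm (grad u x) powr p) \<partial>lborel)"
    by (rule sum_distrib_left[symmetric])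
  also have "(\<Sum>y\<in>F. \<integral>\<^sup>+x\<in>V y. ennreal (norm (grad u x) powr p) \<partial>lborel)
      = (\<integral>\<^sup>+x. (\<Sum>y\<in>F. ennreal (norm (grad u x) powr p) * indicator (V y) x) \<partial>lborel)"
    by (rule nn_integral_sum[symmetric]) measurable
  also have "ennreal (R powr p) * \<dots> \<le> ennreal (R powr p) * (\<integral>\<^sup>+x. ennreal (norm (grad u x) powr p) \<partial>lborel)"
  proof (intro mult_left_mono nn_integral_mono_AE)
    \<comment> \<open>Off the finitely many bisectors a point lies in at most one cell, so the sum
      over the cells counts the gradient at most once.\<close>
    have "AE x in lborel. \<forall>y\<in>F. \<forall>z\<in>F. y \<noteq> z \<longrightarrow> dist x y \<noteq> dist x z"
      using F(1) by (auto simp: AE_ball_countable countable_finite AE_dist_neq intro!: AE_impI)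
    then show "AE x in lborel. (\<Sum>y\<in>F. ennreal (norm (grad u x) powr p) * indicator (V y) x)
        \<le> ennreal (norm (grad u x) powr p)"
    proof eventually_elim
      case (elim x)
      show ?case
      proof (cases "\<exists>y\<in>F. x \<in> V y")
        case True
        then obtain y where y: "y \<in> F" "x \<in> V y" by blast
        have "x \<notin> V z" if "z \<in> F - {y}" for z
          using that elim y by (force simp: V_def)
        then have "(\<Sum>z\<in>F. ennreal (norm (grad u x) powr p) * indicator (V z) x)
            = (\<Sum>z\<in>{y}. ennreal (norm (grad u x) powr p) * indicator (V z) x)"
          using F(1) y(1) by (intro sum.mono_neutral_right) auto
        then show ?thesis using y by simp
      next
        case False
        then have "(\<Sum>z\<in>F. ennreal (norm (grad u x) powr p) * indicator (V z) x) = 0"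
          by (intro sum.neutral) auto
        then show ?thesis by simp
      qed
    qed
  qed simp
  finally show ?thesis .
qed

section \<open>The case \<open>q = \<infinity>\<close> and interpolation\<close>

lemma not_AE_notin_open:
  fixes U :: "'a::euclidean_space set"
  assumes "open U" "AE x in lebesgue. x \<notin> U"
  shows "U = {}"
proof -
  have "U \<in> null_sets lebesgue"
    using assms by (subst AE_iff_null_sets) auto
  then show ?thesis
    using open_not_negligible[OF assms(1)] by (auto simp: negligible_iff_null_sets)
qed

text \<open>If the essential supremum were below |f x0|, the points of \<open>S\<close> where |f|
  exceeds it would form a nonempty open null set.\<close>

lemma Lp_norm_infinity_eq:
  fixes f :: "'a::euclidean_space \<Rightarrow> real"
  assumes f: "continuous_on UNIV f" and S: "open S" "x0 \<in> S"
    and max: "\<And>x. x \<in> S \<Longrightarrow> \<bar>f x\<bar> \<le> \<bar>f x0\<bar>"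
  shows "Lp_norm \<infinity> S f = \<bar>f x0\<bar>"
proof -
  let ?F = "\<lambda>x. ennreal (norm (f x))"
  let ?e = "esssup (lebesgue_on S) ?F"
  have S': "S \<inter> space lebesgue \<in> sets lebesgue" using S(1) by simp
  have "f \<in> borel_measurable lborel"
    using borel_measurable_continuous_onI[OF f] by simp
  then have [measurable]: "f \<in> borel_measurable (lebesgue_on S)"
    by (intro measurable_restrict_space1 measurable_completion)
  have "?e \<le> ennreal \<bar>f x0\<bar>"
    using max by (intro esssup_I AE_I2) (auto simp: space_restrict_space intro!: ennreal_leI)
  moreover have "ennreal \<bar>f x0\<bar> \<le> ?e"
  proof (rule ccontr)
    assume "\<not> ennreal \<bar>f x0\<bar> \<le> ?e"
    then have less: "?e < ennreal \<bar>f x0\<bar>" by simp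
    then obtain b where b: "0 \<le> b" "?e = ennreal b"
      by (cases ?e) auto
    with less have "b < \<bar>f x0\<bar>" by (simp add: ennreal_less_iff)
    let ?U = "S \<inter> {x. b < \<bar>f x\<bar>}"
    have "open ?U"
      using S(1) f by (intro open_Int open_Collect_less continuous_intros)
    moreover have "AE x in lebesgue_on S. ?F x \<le> ?e" by (rule esssup_AE)
    then have "AE x in lebesgue. x \<in> S \<longrightarrow> ?F x \<le> ennreal b"
      using S' b by (simp add: AE_restrict_space_iff)
    then have "AE x in lebesgue. x \<notin> ?U"
      by eventually_elim (use b in \<open>auto simp: ennreal_le_iff\<close>)
    ultimately have "?U = {}" by (rule not_AE_notin_open)
    then show False using S(2) \<open>b < \<bar>f x0\<bar>\<close> by blast
  qed
  ultimately have "?e = ennreal \<bar>f x0\<bar>" by (rule antisym)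
  then show ?thesis by (simp add: Lp_norm_def)
qed

text \<open>The competitor is v z = u(y + R z) / |u x0|. Its gradient contributes R^p / |u x0|^p and
  the change of variables R^(-N), which gives the exponent p - N.\<close>

lemma punctured_const_infinity_bound:
  fixes u :: "'a::euclidean_space \<Rightarrow> real"
  assumes p: "0 < p" and u: "\<And>x. u differentiable (at x)" "continuous_on UNIV (grad u)"
    and max: "\<And>x. \<bar>u x\<bar> \<le> \<bar>u x0\<bar>" "u x0 \<noteq> 0" and y: "u y = 0" "dist x0 y < R"
    and D: "0 \<le> D" "(\<integral>\<^sup>+x. ennreal (norm (grad u x) powr p) \<partial>lborel) = ennreal D"
  shows "0 \<le> punctured_const p \<infinity> TYPE('a)"
    and "punctured_const p \<infinity> TYPE('a) * \<bar>u x0\<bar> powr p \<le> R powr (p - DIM('a)) * D"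
proof -
  have contu: "continuous_on UNIV u"
    using u(1) by (simp add: continuous_at_imp_continuous_on differentiable_imp_continuous_within)
  have [measurable]: "u \<in> borel_measurable borel" "grad u \<in> borel_measurable borel"
    using contu u(2) by (auto intro: borel_measurable_continuous_onI)
  have R: "0 < R" using y(2) by (rule le_less_trans[OF zero_le_dist])
  define k where "k = 1 / \<bar>u x0\<bar>"
  have k: "0 < k" using max(2) by (simp add: k_def)
  define v where "v z = k * u (y + R *\<^sub>R z)" for z
  have der: "(v has_derivative (\<lambda>h. h \<bullet> ((k * R) *\<^sub>R grad u (y + R *\<^sub>R z)))) (at z)" for z
  proof -
    have 1: "((\<lambda>z. y + R *\<^sub>R z) has_derivative (\<lambda>h. R *\<^sub>R h)) (at z)"
      by (auto intro!: derivative_eq_intros)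
    have "((\<lambda>z. u (y + R *\<^sub>R z)) has_derivative (\<lambda>h. (R *\<^sub>R h) \<bullet> grad u (y + R *\<^sub>R z))) (at z)"
      using has_derivative_compose[OF 1 has_derivative_grad[OF u(1)]] .
    from has_derivative_mult_right[OF this, of k] show ?thesis
      unfolding v_def by (simp add: mult_ac)
  qed
  have gv: "grad v z = (k * R) *\<^sub>R grad u (y + R *\<^sub>R z)" for z
    by (rule grad_eqI[OF der])
  have cgv: "continuous_on UNIV (grad v)"
    unfolding gv[abs_def]
    by (intro continuous_intros continuous_on_compose2[OF u(2)]) auto
  have cv: "continuous_on UNIV v"
    unfolding v_def by (intro continuous_intros continuous_on_compose2[OF contu]) auto
  have "bounded (grad v ` cball 0 1)"
    by (intro compact_imp_bounded compact_continuous_image continuous_on_subset[OF cgv]) auto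
  then obtain B where B: "0 < B" "\<And>z. z \<in> cball 0 1 \<Longrightarrow> norm (grad v z) \<le> B"
    unfolding bounded_pos by auto
  have lip: "B-lipschitz_on (cball 0 1) v"
  proof (rule lipschitz_onI)
    fix z w :: 'a assume "z \<in> cball 0 1" "w \<in> cball 0 1"
    moreover have "onorm (\<lambda>h. h \<bullet> grad v z) \<le> B" if "z \<in> cball 0 1" for z
    proof (rule onorm_le)
      fix h :: 'a
      have "norm (h \<bullet> grad v z) \<le> norm h * norm (grad v z)"
        using Cauchy_Schwarz_ineq2 by simp
      also have "\<dots> \<le> norm h * B" using B(2)[OF that] by (intro mult_left_mono) auto
      finally show "norm (h \<bullet> grad v z) \<le> B * norm h" by (simp add: mult.commute)
    qed
    ultimately have "norm (v z - v w) \<le> B * norm (z - w)"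
      using der unfolding gv[symmetric]
      by (intro differentiable_bound[of "cball 0 1" v "\<lambda>z h. h \<bullet> grad v z"])
        (auto intro: has_derivative_at_withinI)
    then show "dist (v z) (v w) \<le> B * dist z w" by (simp add: dist_norm)
  qed (use B in simp)
  \<comment> \<open>The point sent to \<open>x0\<close> by the rescaling. It lies in the open ball
    because dist x0 y < R, so the supremum of |v| over the ball really is 1.\<close>
  define z0 where "z0 = (x0 - y) /\<^sub>R R"
  have vz0: "\<bar>v z0\<bar> = 1" using R max(2) by (simp add: v_def z0_def k_def)
  have "norm z0 = dist x0 y / R" using R by (simp add: z0_def dist_norm divide_inverse mult.commute)
  then have "z0 \<in> ball 0 1" using R y(2) by simp
  moreover have "\<bar>v z\<bar> \<le> \<bar>v z0\<bar>" for z
    unfolding vz0 using max(1)[of "y + R *\<^sub>R z"] max(2) by (simp add: v_def k_def abs_mult)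
  ultimately have norm1: "Lp_norm \<infinity> (ball 0 1) v = 1"
    using Lp_norm_infinity_eq[OF cv open_ball, of z0 0 1] vz0 by simp
  have v0: "v 0 = 0" using y(1) by (simp add: v_def)
  show "0 \<le> punctured_const p \<infinity> TYPE('a)"
    by (rule punctured_const_nonneg[OF lip norm1 v0])
  \<comment> \<open>The integral of |grad u(y + R z)|^p over all z. The energy of \<open>v\<close>
    on the unit ball is bounded by enlarging the ball to the whole space.\<close>
  let ?E = "R powr (- DIM('a)) * D"
  have "ennreal (R ^ DIM('a)) * (\<integral>\<^sup>+z. ennreal (norm (grad u (y + R *\<^sub>R z)) powr p) \<partial>lborel) = ennreal D"
    using nn_integral_lborel_scale[of "\<lambda>x. ennreal (norm (grad u x) powr p)" R y] R D(2) by simp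
  then have "ennreal (R powr (- DIM('a))) * (ennreal (R ^ DIM('a)) *
      (\<integral>\<^sup>+z. ennreal (norm (grad u (y + R *\<^sub>R z)) powr p) \<partial>lborel)) = ennreal ?E"
    using D(1) by (simp add: ennreal_mult)
  moreover have "R powr (- DIM('a)) * R ^ DIM('a) = 1"
    using R by (simp add: powr_minus powr_realpow)
  then have "ennreal (R powr (- DIM('a))) * ennreal (R ^ DIM('a)) = 1"
    using R by (simp add: ennreal_mult[symmetric])
  ultimately have scale: "(\<integral>\<^sup>+z. ennreal (norm (grad u (y + R *\<^sub>R z)) powr p) \<partial>lborel) = ennreal ?E"
    by (simp add: mult.assoc[symmetric])
  have "(\<integral>\<^sup>+z\<in>ball 0 1. ennreal (norm (grad v z) powr p) \<partial>lborel)
      \<le> (\<integral>\<^sup>+z. ennreal ((k * R) powr p) * ennreal (norm (grad u (y + R *\<^sub>R z)) powr p) \<partial>lborel)"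
    using k R by (intro nn_integral_mono)
      (auto simp: gv indicator_def abs_mult powr_mult ennreal_mult[symmetric])
  also have "\<dots> = ennreal ((k * R) powr p) * ennreal ?E"
    by (subst nn_integral_cmult) (simp_all add: scale)
  also have "\<dots> = ennreal ((k * R) powr p * ?E)"
    using D(1) by (simp add: ennreal_mult)
  finally have "enn2real (\<integral>\<^sup>+z\<in>ball 0 1. ennreal (norm (grad v z) powr p) \<partial>lborel) \<le> (k * R) powr p * ?E"
    using D(1) by (intro enn2real_leI) auto
  moreover have "(LINT z|lebesgue_on (ball 0 1). norm (grad v z) powr p)
      = enn2real (\<integral>\<^sup>+z\<in>ball 0 1. ennreal (norm (grad v z) powr p) \<partial>lborel)"
    using borel_measurable_continuous_onI[OF cgv]
    by (intro LINT_lebesgue_on_eq_enn2real) auto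
  ultimately have "(LINT z|lebesgue_on (ball 0 1). norm (grad v z) powr p) \<le> (k * R) powr p * ?E"
    by simp
  with punctured_const_le[OF lip norm1 v0, of p]
  have "punctured_const p \<infinity> TYPE('a) \<le> (k * R) powr p * ?E" by (rule order_trans)
  then have "punctured_const p \<infinity> TYPE('a) * \<bar>u x0\<bar> powr p \<le> ((k * R) powr p * ?E) * \<bar>u x0\<bar> powr p"
    by (rule mult_right_mono) simp
  also have "\<dots> = (k powr p * \<bar>u x0\<bar> powr p) * (R powr p * R powr (- DIM('a))) * D"
    using k R by (simp add: powr_mult mult_ac)
  also have "k powr p * \<bar>u x0\<bar> powr p = 1"
    using max(2) by (simp add: k_def powr_mult[symmetric])
  also have "R powr p * R powr (- DIM('a)) = R powr (p - DIM('a))"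
    by (simp add: powr_add[symmetric])
  also have "1 * R powr (p - DIM('a)) * D = R powr (p - DIM('a)) * D"
    by simp
  finally show "punctured_const p \<infinity> TYPE('a) * \<bar>u x0\<bar> powr p \<le> R powr (p - DIM('a)) * D" .
qed

section \<open>Test functions, the inradius, and the final estimate\<close>

lemma test_functionsD:
  fixes u :: "'a::euclidean_space \<Rightarrow> real"
  assumes "u \<in> test_functions \<Omega>"
  obtains S where "compact S" "S \<subseteq> \<Omega>" "\<And>x. u differentiable (at x)" "continuous_on UNIV (grad u)"
    "\<And>x. x \<notin> S \<Longrightarrow> u x = 0" "\<And>x. x \<notin> S \<Longrightarrow> grad u x = 0"
proof -
  let ?S = "closure {x. u x \<noteq> 0}"
  have u: "compact ?S" "?S \<subseteq> \<Omega>" "C_k (Suc 0) u"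
    using assms unfolding test_functions_def by blast+
  then have diff: "\<And>x. u differentiable (at x)"
    and comp: "\<And>i. i \<in> Basis \<Longrightarrow> continuous_on UNIV (\<lambda>x. grad u x \<bullet> i)"
    by simp_all
  have "continuous_on UNIV (\<lambda>x. \<Sum>i\<in>Basis. (grad u x \<bullet> i) *\<^sub>R i)"
    by (intro continuous_on_sum continuous_on_scaleR continuous_on_const comp)
  then have cont: "continuous_on UNIV (grad u)"
    by (simp add: euclidean_representation)
  have z: "u x = 0" if "x \<notin> ?S" for x
    using that closure_subset[of "{x. u x \<noteq> 0}"] by blast
  have "grad u x = 0" if "x \<notin> ?S" for x
  proof (rule grad_eqI)
    show "(u has_derivative (\<lambda>h. h \<bullet> 0)) (at x)"
    proof (rule has_derivative_transform_within_open)
      show "((\<lambda>_. 0) has_derivative (\<lambda>h. h \<bullet> 0)) (at x)" by simp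
      show "open (- ?S)" by (intro open_Compl closed_closure)
      show "x \<in> - ?S" using that unfolding Compl_iff .
      show "0 = u w" if "w \<in> - ?S" for w using z[OF ComplD[OF that]] by (rule sym)
    qed
  qed
  with u(1,2) diff cont z show thesis by (rule that)
qed

text \<open>The compact support makes the integral finite, so it survives the conversion to a real
  number, and the extension by zero makes integration over \<open>\<Omega>\<close> and over the
  whole space agree.\<close>

lemma nn_integral_eq_LINT:
  fixes f :: "'a::euclidean_space \<Rightarrow> real"
  assumes f: "continuous_on UNIV f" "\<And>x. 0 \<le> f x" and S: "compact S" "\<And>x. x \<notin> S \<Longrightarrow> f x = 0"
    and \<Omega>: "S \<subseteq> \<Omega>" "open \<Omega>"
  shows "(\<integral>\<^sup>+x. ennreal (f x) \<partial>lborel) = ennreal (LINT x|lebesgue_on \<Omega>. f x)"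
proof -
  have "bounded (f ` S)"
    by (intro compact_imp_bounded compact_continuous_image continuous_on_subset[OF f(1)] S) auto
  then obtain B where B: "0 < B" "\<And>x. x \<in> S \<Longrightarrow> f x \<le> B"
    unfolding bounded_pos by fastforce
  have [measurable]: "S \<in> sets borel" using S(1) by (simp add: borel_compact)
  have "(\<integral>\<^sup>+x. ennreal (f x) \<partial>lborel) \<le> (\<integral>\<^sup>+x. ennreal B * indicator S x \<partial>lborel)"
    using B S(2) by (intro nn_integral_mono) (auto simp: indicator_def intro!: ennreal_leI)
  also have "\<dots> = ennreal B * emeasure lborel S"
    by (rule nn_integral_cmult_indicator) simp
  also have "\<dots> < \<infinity>"
    using emeasure_bounded_finite[OF compact_imp_bounded[OF S(1)]] by (simp add: ennreal_mult_less_top)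
  finally have fin: "(\<integral>\<^sup>+x. ennreal (f x) \<partial>lborel) < \<infinity>" .
  have "(LINT x|lebesgue_on \<Omega>. f x) = enn2real (\<integral>\<^sup>+x\<in>\<Omega>. ennreal (f x) \<partial>lborel)"
    using f \<Omega>(2) borel_measurable_continuous_onI[OF f(1)] by (intro LINT_lebesgue_on_eq_enn2real) auto
  also have "(\<integral>\<^sup>+x\<in>\<Omega>. ennreal (f x) \<partial>lborel) = (\<integral>\<^sup>+x. ennreal (f x) \<partial>lborel)"
  proof (rule nn_integral_cong)
    fix x
    have "f x = 0" if "x \<notin> \<Omega>" using that S(2) \<Omega>(1) by blast
    then show "ennreal (f x) * indicator \<Omega> x = ennreal (f x)" by (simp add: indicator_def)
  qed
  finally show ?thesis using fin by simp
qed

lemma nn_integral_continuous_pos: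
  fixes f :: "'a::euclidean_space \<Rightarrow> real"
  assumes f: "continuous_on UNIV f" and x0: "0 < f x0"
  shows "0 < (\<integral>\<^sup>+x. ennreal (f x) \<partial>lborel)"
proof (rule ccontr)
  assume "\<not> ?thesis"
  then have "AE x in lborel. ennreal (f x) = 0"
    using borel_measurable_continuous_onI[OF f] by (subst nn_integral_0_iff_AE[symmetric]) auto
  then have "AE x in lborel. x \<notin> {x. 0 < f x}"
    by eventually_elim (auto simp: ennreal_eq_0_iff)
  then have "AE x in lebesgue. x \<notin> {x. 0 < f x}"
    by (rule AE_completion)
  moreover have "open {x. 0 < f x}"
    using f by (intro open_Collect_less continuous_intros)
  ultimately have "{x. 0 < f x} = {}" by (intro not_AE_notin_open)
  then show False using x0 by blast
qed

text \<open>Both claims rest on the fact that a ball inside \<open>\<Omega>\<close> has radius at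
  most the inradius. A ball about \<open>x\<close> of larger radius must therefore contain a point
  outside \<open>\<Omega>\<close>.\<close>

lemma
  assumes fin: "inradius \<Omega> < \<infinity>"
  shows inradius_pos: "open \<Omega> \<Longrightarrow> x \<in> \<Omega> \<Longrightarrow> 0 < enn2real (inradius \<Omega>)"
    and ex_near_complement: "enn2real (inradius \<Omega>) < R \<Longrightarrow> \<exists>y. y \<notin> \<Omega> \<and> dist x y < R"
proof -
  have ball: "r \<le> enn2real (inradius \<Omega>)" if "0 < r" "ball x r \<subseteq> \<Omega>" for x r
  proof -
    have "ennreal r \<le> inradius \<Omega>"
      unfolding inradius_def using that by (intro SUP_upper) auto
    then show ?thesis using fin that(1) by (cases "inradius \<Omega>") (auto simp: ennreal_le_iff)
  qed
  show "0 < enn2real (inradius \<Omega>)" if "open \<Omega>" "x \<in> \<Omega>"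
    using open_contains_ball that ball by (metis less_le_trans)
  show "\<exists>y. y \<notin> \<Omega> \<and> dist x y < R" if R: "enn2real (inradius \<Omega>) < R"
  proof (rule ccontr)
    assume "\<not> ?thesis"
    then have "ball x R \<subseteq> \<Omega>" by (auto simp: subset_iff)
    moreover have "0 < R" using R enn2real_nonneg[of "inradius \<Omega>"] by linarith
    ultimately show False using ball[of R x] R by simp
  qed
qed

text \<open>Points of the complement are found only within distances R strictly above the inradius,
  so each bound is proved for those R and passed to the limit R -> r by continuity.\<close>

lemma le_powr_mult_limit:
  fixes r :: real
  assumes "0 < r" "\<And>R. r < R \<Longrightarrow> A \<le> R powr e * D"
  shows "A \<le> r powr e * D"
proof (rule tendsto_lowerbound)
  show "((\<lambda>R. R powr e * D) \<longlongrightarrow> r powr e * D) (at_right r)"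
    using assms(1) by (intro tendsto_intros) auto
  show "\<forall>\<^sub>F R in at_right r. A \<le> R powr e * D"
    using assms(2) by (auto simp: eventually_at_right_field intro!: exI[of _ "r + 1"])
qed simp

text \<open>Here \<open>P\<close>, \<open>m\<close>, \<open>W\<close>, \<open>D\<close> play the
  roles of the p-th powers of the L^p, L^\<infinity> and L^q norms of u and of the L^p norm of its
  gradient. Multiply the \<theta>-th power of the first bound by the (1-\<theta>)-th power of the
  second: the exponents of \<open>D\<close> add up to 1 and those of \<open>r\<close> to p \<theta>
  + (p-N)(1-\<theta>) = p - N + N \<theta>.\<close>

lemma interpolate_bounds:
  fixes b L r D P m W p N \<theta> :: real
  assumes "0 < b" "0 \<le> L" "0 < r" "0 < P" "0 < m" "0 \<le> \<theta>" "\<theta> \<le> 1"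
    and bP: "b * P \<le> r powr p * D" and Lm: "L * m \<le> r powr (p - N) * D"
    and W: "0 < W" "W \<le> P powr \<theta> * m powr (1 - \<theta>)"
  shows "b powr \<theta> * L powr (1 - \<theta>) * (1 / r) powr (p - N + N * \<theta>) \<le> D / W"
proof -
  have "0 < r powr p * D" using bP assms(1,4) by (meson less_le_trans mult_pos_pos)
  then have D: "0 < D" using assms(3) by (simp add: zero_less_mult_iff)
  have "(b * P) powr \<theta> \<le> (r powr p * D) powr \<theta>"
    using assms by (intro powr_mono2 bP) auto
  moreover have "(L * m) powr (1 - \<theta>) \<le> (r powr (p - N) * D) powr (1 - \<theta>)"
    using assms by (intro powr_mono2 Lm) auto
  ultimately have prod: "(b * P) powr \<theta> * (L * m) powr (1 - \<theta>)
      \<le> (r powr p * D) powr \<theta> * (r powr (p - N) * D) powr (1 - \<theta>)"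
    by (rule mult_mono) auto
  have "(b powr \<theta> * L powr (1 - \<theta>)) * W \<le> (b powr \<theta> * L powr (1 - \<theta>)) * (P powr \<theta> * m powr (1 - \<theta>))"
    using W by (intro mult_left_mono) auto
  also have "\<dots> = (b * P) powr \<theta> * (L * m) powr (1 - \<theta>)"
    using assms by (simp add: powr_mult)
  also have "\<dots> \<le> (r powr p * D) powr \<theta> * (r powr (p - N) * D) powr (1 - \<theta>)"
    by (rule prod)
  also have "\<dots> = (r powr (p * \<theta>) * r powr ((p - N) * (1 - \<theta>))) * (D powr \<theta> * D powr (1 - \<theta>))"
    using D assms(3) by (simp add: powr_mult powr_powr)
  also have "\<dots> = r powr (p - N + N * \<theta>) * D"
    using D unfolding powr_add[symmetric] by (simp add: algebra_simps)
  finally show ?thesis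
    using W(1) assms(3) by (simp add: powr_divide field_simps)
qed

theorem corollary4p7:
  fixes \<Omega> :: "(real ^ 'n) set" and N p :: real and q :: ereal
  defines "N \<equiv> real CARD('n)"
  assumes "open \<Omega>" and "inradius \<Omega> < \<infinity>"
    and "N < p" and "ereal p \<le> q"
  shows "lambda_pq p q \<Omega> \<ge>
    ennreal (beta p TYPE(real ^ 'n) powr real_of_ereal (ereal p / q)
      * punctured_const p \<infinity> TYPE(real ^ 'n) powr (1 - real_of_ereal (ereal p / q))
      * (1 / enn2real (inradius \<Omega>)) powr (p - N + N * real_of_ereal (ereal p / q)))"
  unfolding lambda_pq_def
proof (rule INF_greatest)
  fix u :: "real ^ 'n \<Rightarrow> real" assume "u \<in> test_functions \<Omega> - {\<lambda>_. 0}"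
  then have u: "u \<in> test_functions \<Omega>" and u0: "u \<noteq> (\<lambda>_. 0)" by auto
  let ?b = "beta p TYPE(real ^ 'n)" and ?L = "punctured_const p \<infinity> TYPE(real ^ 'n)"
  define r where "r = enn2real (inradius \<Omega>)"
  define \<theta> where "\<theta> = real_of_ereal (ereal p / q)"
  have DIM: "real DIM(real ^ 'n) = N" by (simp add: N_def)
  with \<open>N < p\<close> have p: "real DIM(real ^ 'n) < p" by simp
  have p0: "0 < p" using p by (rule le_less_trans[OF of_nat_0_le_iff])
  obtain S where S: "compact S" "S \<subseteq> \<Omega>" and diff: "\<And>x. u differentiable (at x)"
    and cont: "continuous_on UNIV (grad u)"
    and uS: "\<And>x. x \<notin> S \<Longrightarrow> u x = 0" and gS: "\<And>x. x \<notin> S \<Longrightarrow> grad u x = 0"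
    using u by (rule test_functionsD) blast
  have contu: "continuous_on UNIV u"
    using diff by (simp add: continuous_at_imp_continuous_on differentiable_imp_continuous_within)
  obtain a where a: "u a \<noteq> 0" using u0 by blast
  with uS have "a \<in> S" by blast
  then have r: "0 < r" using inradius_pos[OF assms(3,2)] S(2) by (auto simp: r_def)
  obtain x0 where x0: "x0 \<in> S" "\<And>x. x \<in> S \<Longrightarrow> \<bar>u x\<bar> \<le> \<bar>u x0\<bar>"
    using continuous_attains_sup[OF S(1), of "\<lambda>x. \<bar>u x\<bar>"] \<open>a \<in> S\<close> continuous_on_subset[OF contu]
    by (auto intro: continuous_on_rabs)
  have max: "\<bar>u x\<bar> \<le> \<bar>u x0\<bar>" for x
    using x0(2)[of x] uS[of x] by (cases "x \<in> S") auto
  have x0nz: "u x0 \<noteq> 0" using max[of a] a by auto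
  define D where "D = (LINT x|lebesgue_on \<Omega>. norm (grad u x) powr p)"
  define P where "P = (LINT x|lebesgue_on \<Omega>. \<bar>u x\<bar> powr p)"
  have "continuous_on UNIV (\<lambda>x. norm (grad u x) powr p)"
    using p0 by (intro continuous_on_powr' continuous_on_norm cont continuous_on_const) auto
  from nn_integral_eq_LINT[OF this _ S(1) _ S(2) \<open>open \<Omega>\<close>]
  have "(\<integral>\<^sup>+x. ennreal (norm (grad u x) powr p) \<partial>lborel) = ennreal D"
    unfolding D_def by (simp add: gS)
  moreover have "0 \<le> D" unfolding D_def by simp
  ultimately have D: "0 \<le> D" "(\<integral>\<^sup>+x. ennreal (norm (grad u x) powr p) \<partial>lborel) = ennreal D"
    by auto
  have c_powr: "continuous_on UNIV (\<lambda>x. \<bar>u x\<bar> powr s)" if "0 < s" for s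
    using that by (intro continuous_on_powr' continuous_on_rabs contu continuous_on_const) auto
  have P_eq: "(\<integral>\<^sup>+x. ennreal (\<bar>u x\<bar> powr s) \<partial>lborel) = ennreal (LINT x|lebesgue_on \<Omega>. \<bar>u x\<bar> powr s)"
    if "0 < s" for s
    by (rule nn_integral_eq_LINT[OF c_powr[OF that] _ S(1) _ S(2) \<open>open \<Omega>\<close>]) (simp_all add: uS)
  have P_pos: "0 < (LINT x|lebesgue_on \<Omega>. \<bar>u x\<bar> powr s)" if "0 < s" for s
  proof -
    have "0 < (\<integral>\<^sup>+x. ennreal (\<bar>u x\<bar> powr s) \<partial>lborel)"
      by (rule nn_integral_continuous_pos[OF c_powr[OF that], of a]) (simp add: a)
    then show ?thesis by (simp add: P_eq[OF that])
  qed
  have bP: "?b * P \<le> r powr p * D"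
  proof (rule le_powr_mult_limit[OF r])
    fix R assume R: "r < R"
    \<comment> \<open>Every point is closer than R to the complement of \<open>\<Omega>\<close>;
      compactness of \<open>S\<close> then yields the finite set of centres. Each centre has a
      neighbourhood disjoint from \<open>S\<close>, on which u vanishes.\<close>
    have "S \<subseteq> (\<Union>y\<in>- \<Omega>. ball y R)"
      using ex_near_complement[OF assms(3)] R by (fastforce simp: r_def dist_commute)
    then obtain F where F: "F \<subseteq> - \<Omega>" "finite F" "S \<subseteq> (\<Union>y\<in>F. ball y R)"
      using compactE_image[OF S(1), of "- \<Omega>" "\<lambda>y. ball y R"] by auto
    have "ennreal ?b * (\<integral>\<^sup>+x. ennreal (\<bar>u x\<bar> powr p) \<partial>lborel)
        \<le> ennreal (R powr p) * (\<integral>\<^sup>+x. ennreal (norm (grad u x) powr p) \<partial>lborel)"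
    proof (rule Poincare_near_finite_set[OF p diff cont F(2)])
      show "\<exists>y\<in>F. dist x y \<le> R" if "u x \<noteq> 0" for x
      proof -
        have "x \<in> S" using that uS by blast
        then show ?thesis using F(3) by (force simp: dist_commute)
      qed
      show "\<exists>\<delta>>0. \<forall>x. dist x y < \<delta> \<longrightarrow> u x = 0" if "y \<in> F" for y
      proof -
        have "open (- S)" "y \<in> - S" using S F(1) that by (auto simp: compact_imp_closed)
        then obtain \<delta> where "0 < \<delta>" "\<forall>x. dist x y < \<delta> \<longrightarrow> x \<in> - S" unfolding open_dist by blast
        then show ?thesis using uS by blast
      qed
    qed
    then have "ennreal (?b * P) \<le> ennreal (R powr p * D)"
      using beta_pos[OF p] P_pos[OF p0] D P_eq[OF p0] by (simp add: P_def ennreal_mult)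
    then show "?b * P \<le> R powr p * D" using D(1) by simp
  qed
  \<comment> \<open>The sign of \<open>?L\<close> comes along because the rescaled u is itself an
    admissible competitor.\<close>
  have L: "0 \<le> ?L \<and> ?L * \<bar>u x0\<bar> powr p \<le> R powr (p - N) * D" if R: "r < R" for R
  proof -
    obtain y where y: "y \<notin> \<Omega>" "dist x0 y < R"
      using ex_near_complement[OF assms(3)] R unfolding r_def by blast
    then have "u y = 0" using uS S(2) by blast
    from punctured_const_infinity_bound[OF p0 diff cont max x0nz this y(2) D]
    show ?thesis unfolding DIM by simp
  qed
  have L0: "0 \<le> ?L" using L[of "r + 1"] by simp
  have LM: "?L * \<bar>u x0\<bar> powr p \<le> r powr (p - N) * D"
    using L by (intro le_powr_mult_limit[OF r]) blast
  define W where "W = Lp_norm q \<Omega> u powr p"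
  have W: "0 < W \<and> W \<le> P powr \<theta> * (\<bar>u x0\<bar> powr p) powr (1 - \<theta>) \<and> 0 \<le> \<theta> \<and> \<theta> \<le> 1"
  proof (cases q)
    case (real s)
    with assms(5) p0 have s: "p \<le> s" "0 < s" by auto
    have \<theta>: "\<theta> = p / s" using real s by (simp add: \<theta>_def)
    define Q where "Q = (LINT x|lebesgue_on \<Omega>. \<bar>u x\<bar> powr s)"
    have Q: "0 < Q" unfolding Q_def using s(2) by (rule P_pos)
    have W_eq: "W = Q powr \<theta>"
      using real by (simp add: W_def Lp_norm_def Q_def powr_powr \<theta>)
    \<comment> \<open>Interpolation between L^p and L^\<infinity>: the surplus power |u|^(s-p) is
      bounded by its maximum, and raising to the power \<theta> = p/s gives the claim.\<close>
    have "(\<integral>\<^sup>+x. ennreal (\<bar>u x\<bar> powr s) \<partial>lborel)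
        \<le> (\<integral>\<^sup>+x. ennreal (\<bar>u x0\<bar> powr (s - p)) * ennreal (\<bar>u x\<bar> powr p) \<partial>lborel)"
    proof (rule nn_integral_mono)
      fix x
      have "\<bar>u x\<bar> powr s = \<bar>u x\<bar> powr (s - p) * \<bar>u x\<bar> powr p"
        by (simp add: powr_add[symmetric])
      also have "\<dots> \<le> \<bar>u x0\<bar> powr (s - p) * \<bar>u x\<bar> powr p"
        using s max by (intro mult_right_mono powr_mono2) auto
      finally show "ennreal (\<bar>u x\<bar> powr s) \<le> ennreal (\<bar>u x0\<bar> powr (s - p)) * ennreal (\<bar>u x\<bar> powr p)"
        by (simp add: ennreal_mult[symmetric] ennreal_leI)
    qed
    also have "\<dots> = ennreal (\<bar>u x0\<bar> powr (s - p)) * (\<integral>\<^sup>+x. ennreal (\<bar>u x\<bar> powr p) \<partial>lborel)"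
      using borel_measurable_continuous_onI[OF contu] by (intro nn_integral_cmult) auto
    finally have "ennreal Q \<le> ennreal (\<bar>u x0\<bar> powr (s - p) * P)"
      using P_pos[OF p0] by (simp add: P_eq[OF s(2)] P_eq[OF p0] Q_def P_def ennreal_mult)
    then have "Q \<le> \<bar>u x0\<bar> powr (s - p) * P"
      using P_pos[OF p0] by (simp add: P_def)
    then have "W \<le> (\<bar>u x0\<bar> powr (s - p) * P) powr \<theta>"
      unfolding W_eq using Q s p0 by (intro powr_mono2) (auto simp: \<theta>)
    also have "\<dots> = P powr \<theta> * \<bar>u x0\<bar> powr ((s - p) * \<theta>)"
      using P_pos[OF p0] by (simp add: P_def powr_mult powr_powr)
    also have "(s - p) * \<theta> = p * (1 - \<theta>)" using s by (simp add: \<theta> field_simps)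
    finally show ?thesis
      using Q s p0 by (simp add: W_eq \<theta> powr_powr)
  next
    \<comment> \<open>Now \<theta> = 0. Positivity of \<open>P\<close> matters, because
      \<open>P powr 0\<close> is 1 only for nonzero \<open>P\<close>.\<close>
    case PInf
    have "Lp_norm \<infinity> \<Omega> u = \<bar>u x0\<bar>"
      using contu \<open>open \<Omega>\<close> x0(1) S(2) max by (intro Lp_norm_infinity_eq) auto
    then show ?thesis
      using PInf x0nz P_pos[OF p0] by (simp add: W_def \<theta>_def P_def)
  qed (use assms(5) in simp)
  have "Lp_norm (ereal p) \<Omega> (grad u) powr p = D"
    using D(1) p0 by (simp add: Lp_norm_def D_def powr_powr)
  moreover have "?b powr \<theta> * ?L powr (1 - \<theta>) * (1 / r) powr (p - N + N * \<theta>) \<le> D / W"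
    using beta_pos[OF p] L0 r P_pos[OF p0] x0nz W bP LM
    by (intro interpolate_bounds[of _ _ _ P "\<bar>u x0\<bar> powr p"]) (auto simp: P_def)
  ultimately show "ennreal (?b powr real_of_ereal (ereal p / q) * ?L powr (1 - real_of_ereal (ereal p / q))
      * (1 / enn2real (inradius \<Omega>)) powr (p - N + N * real_of_ereal (ereal p / q)))
      \<le> ennreal (Lp_norm (ereal p) \<Omega> (grad u) powr p / Lp_norm q \<Omega> u powr p)"
    unfolding r_def \<theta>_def W_def by (intro ennreal_leI) simp
qed

end
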